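(* Let $D$ and $D'$ be virtual link diagrams. If $D$ and $D'$ are equivalent as welded links, then $\phi_+(D)$ and $\phi_+(D')$ are equivalent as welded links, and $\phi_-(D)$ and $\phi_-(D')$ are equivalent as welded links.
   Context: **Diagrams.** A virtual link diagram is a generic immersion of finitely many oriented circles in the plane (considered up to planar isotopy) whose double points are transverse and each marked either as a classical crossing (with over/under information) or as a virtual crossing (no over/under information). A classical crossing is positive if the direction of the over strand is carried to the direction of the under strand by a counterclockwise rotation through an angle less than $\pi$, and negative otherwise. **Welded equivalence.** Two virtual link diagrams are equivalent as welded links if they are related by a finite sequence of planar isotopies and the following local moves (with all orientations): the classical Reidemeister moves I, II, III; the virtual Reidemeister moves, namely the moves I, II, III with all crossings virtual, and the mixed move IV in which a strand meeting two other strands only in virtual crossings is moved across a classical crossing of those two strands; and the welded move, in which a strand passing over (by two classical crossings) two other strands that cross each other virtually is moved across that virtual crossing, remaining over both strands. A welded link is an equivalence class of virtual link diagrams under this relation. **The parallel diagrams $\phi_\pm(D)$.** Given a virtual link diagram $D$, replace every strand $s$ of $D$ by two parallel copies, $s_{\rm R}$ on the right and $s_{\rm L}$ on the left of $s$ (with respect to the orientation of $D$). The crossings are as follows. - At a virtual crossing of $D$, all four resulting crossings are virtual. - At a classical crossing of $D$ with over strand $o$ and under strand $u$: $o_{\rm R}$ and $u_{\rm R}$ cross classically with $o_{\rm R}$ over $u_{\rm R}$; $o_{\rm R}$ and $u_{\rm L}$ cross classically with $o_{\rm R}$ over $u_{\rm L}$; the crossing of $o_{\rm L}$ with $u_{\rm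 R}$ and that of $o_{\rm L}$ with $u_{\rm L}$ are virtual. Moreover a twist is inserted in the pair $(u_{\rm R},u_{\rm L})$ near the crossing. If the crossing of $D$ is positive, then immediately after the crossing along $u$ insert a $-1v$-twist: travelling along $u$, the strands $u_{\rm R},u_{\rm L}$ cross each other first at a classical crossing with $u_{\rm R}$ over $u_{\rm L}$ (a negative crossing when both are oriented parallel to $u$) and then at a virtual crossing, after which $u_{\rm R}$ is again on the right. If the crossing of $D$ is negative, then immediately before the crossing along $u$ insert a $v1$-twist: travelling along $u$, the strands $u_{\rm R},u_{\rm L}$ cross first at a virtual crossing and then at a classical crossing with $u_{\rm R}$ over $u_{\rm L}$ (a positive crossing when both are oriented parallel to $u$). Away from the crossings of $D$ the two copies are just parallel. In $\phi_+(D)$ both copies are oriented parallel to $D$; $\phi_-(D)$ is the same diagram with the orientation of all left copies reversed. *)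

theory Defs
  imports Main
begin

text \<open>
  A generic immersion of oriented circles in the plane, put in general position with respect to the
  height function, is a finite sequence of elementary pieces, one per critical level: a local
  minimum, a local maximum or a crossing, with vertical strands to its left and right. A diagram is
  written as the list of these pieces, from bottom to top. The number in a layer counts the
  vertical strands to the left of its piece. Between two layers the diagram is described by the
  list of the orientations of the strands, from left to right.
\<close>

datatype orientation = Up | Down

fun opp :: "orientation \<Rightarrow> orientation" where
  "opp Up = Down"
| "opp Down = Up"

text \<open>
  At a crossing the rising strand runs, as an unoriented line, from the lower left to the upper
  right, and the falling strand from the upper left to the lower right.
\<close>

datatype crossing =
    RisingOver   \<comment> \<open>classical, rising strand over\<close>
  | FallingOver  \<comment> \<open>classical, falling strand over\<close>
  | Virtual

datatype piece =
    Cup orientation  \<comment> \<open>local minimum; the argument is the orientation of its left arm\<close>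
  | Cap              \<comment> \<open>local maximum\<close>
  | Cross crossing

type_synonym layer = "nat \<times> piece"
type_synonym layers = "layer list"

text \<open>Orientations above a layer, from those below it; \<^const>\<open>None\<close> if they do not match.\<close>

fun layer_top :: "layer \<Rightarrow> orientation list \<Rightarrow> orientation list option" where
  "layer_top (i, Cup d) s =
     (if i \<le> length s then Some (take i s @ [d, opp d] @ drop i s) else None)"
| "layer_top (i, Cap) s =
     (if i + 1 < length s \<and> s ! (i + 1) = opp (s ! i)
      then Some (take i s @ drop (i + 2) s) else None)"
| "layer_top (i, Cross c) s =
     (if i + 1 < length s
      then Some (take i s @ [s ! (i + 1), s ! i] @ drop (i + 2) s) else None)"

fun layers_top :: "layers \<Rightarrow> orientation list \<Rightarrow> orientation list option" where
  "layers_top [] s = Some s"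
| "layers_top (l # w) s = Option.bind (layer_top l s) (layers_top w)"

definition virtual_link_diagram :: "layers \<Rightarrow> bool" where
  "virtual_link_diagram D \<longleftrightarrow> layers_top D [] = Some []"

text \<open>
  Local moves. The orientations of the strands are not mentioned (except at a minimum, where
  they are arbitrary): a move may be applied whenever both sides fit the orientations of the
  strands around them, so every move comes with all its orientations.
\<close>

text \<open>
  The kind of a crossing after a rotation of the plane by a quarter turn. This is also the kind
  of the second crossing of a Reidemeister II bigon whose first crossing is of kind \<open>c\<close>.
\<close>

fun flip :: "crossing \<Rightarrow> crossing" where
  "flip RisingOver = FallingOver"
| "flip FallingOver = RisingOver"
| "flip Virtual = Virtual"

fun strands_below :: "piece \<Rightarrow> nat" where
  "strands_below (Cup d) = 0"
| "strands_below Cap = 2"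
| "strands_below (Cross c) = 2"

fun strands_above :: "piece \<Rightarrow> nat" where
  "strands_above (Cup d) = 2"
| "strands_above Cap = 0"
| "strands_above (Cross c) = 2"

text \<open>
  Planar isotopy passes through the following changes of the position relative to the height
  function: two pieces exchange their heights; a minimum and a maximum next to each other on a
  strand are born or cancel; a maximum or a minimum of one strand moves through a crossing with
  another strand.
\<close>

inductive isotopy_move :: "layers \<Rightarrow> layers \<Rightarrow> bool" where
  exchange: "isotopy_move [(i, p), (i + strands_above p + k, q)]
                          [(i + strands_below p + k, q), (i, p)]"
| straighten_left: "isotopy_move [(i + 1, Cup d), (i, Cap)] []"
| straighten_right: "isotopy_move [(i, Cup d), (i + 1, Cap)] []"
| cap_through: "isotopy_move [(i + 1, Cross c), (i, Cap)] [(i, Cross (flip c)), (i + 1, Cap)]"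
| cup_through: "isotopy_move [(i, Cup d), (i + 1, Cross c)] [(i + 1, Cup d), (i, Cross (flip c))]"

definition kink_right :: "nat \<Rightarrow> orientation \<Rightarrow> crossing \<Rightarrow> layers" where
  "kink_right i d c = [(i + 1, Cup d), (i, Cross c), (i + 1, Cap)]"

definition kink_left :: "nat \<Rightarrow> orientation \<Rightarrow> crossing \<Rightarrow> layers" where
  "kink_left i d c = [(i, Cup d), (i + 1, Cross c), (i, Cap)]"

definition bigon :: "nat \<Rightarrow> crossing \<Rightarrow> layers" where
  "bigon i c = [(i, Cross c), (i, Cross (flip c))]"

text \<open>
  The two sides of a triangle move. Three strands, numbered 1, 2, 3 from left to right at the
  bottom, cross in pairs: the crossing of 1 and 2 has kind \<open>a\<close>, that of 1 and 3 kind \<open>b\<close>, that of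
  2 and 3 kind \<open>c\<close>. In each of these crossings the strand with the smaller number is the rising one.
\<close>

definition triangle :: "nat \<Rightarrow> crossing \<Rightarrow> crossing \<Rightarrow> crossing \<Rightarrow> layers" where
  "triangle i a b c = [(i, Cross a), (i + 1, Cross b), (i, Cross c)]"

definition triangle' :: "nat \<Rightarrow> crossing \<Rightarrow> crossing \<Rightarrow> crossing \<Rightarrow> layers" where
  "triangle' i a b c = [(i + 1, Cross c), (i, Cross b), (i + 1, Cross a)]"

text \<open>Crossing of a rising strand in level \<open>x\<close> with a falling strand in level \<open>y\<close>.\<close>

definition crossing_of_levels :: "nat \<Rightarrow> nat \<Rightarrow> crossing" where
  "crossing_of_levels x y = (if y < x then RisingOver else FallingOver)"

inductive classical_move :: "layers \<Rightarrow> layers \<Rightarrow> bool" where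
  R1_right: "c \<noteq> Virtual \<Longrightarrow> classical_move (kink_right i d c) []"
| R1_left: "c \<noteq> Virtual \<Longrightarrow> classical_move (kink_left i d c) []"
| R2: "c \<noteq> Virtual \<Longrightarrow> classical_move (bigon i c) []"
| R3: "\<lbrakk>distinct [x, y, z]; a = crossing_of_levels x y; b = crossing_of_levels x z;
        c = crossing_of_levels y z\<rbrakk>
       \<Longrightarrow> classical_move (triangle i a b c) (triangle' i a b c)"

inductive virtual_move :: "layers \<Rightarrow> layers \<Rightarrow> bool" where
  V1_right: "virtual_move (kink_right i d Virtual) []"
| V1_left: "virtual_move (kink_left i d Virtual) []"
| V2: "virtual_move (bigon i Virtual) []"
| V3: "virtual_move (triangle i Virtual Virtual Virtual) (triangle' i Virtual Virtual Virtual)"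
| V4_strand1: "c \<noteq> Virtual \<Longrightarrow>
    virtual_move (triangle i Virtual Virtual c) (triangle' i Virtual Virtual c)"
| V4_strand2: "b \<noteq> Virtual \<Longrightarrow>
    virtual_move (triangle i Virtual b Virtual) (triangle' i Virtual b Virtual)"
| V4_strand3: "a \<noteq> Virtual \<Longrightarrow>
    virtual_move (triangle i a Virtual Virtual) (triangle' i a Virtual Virtual)"

text \<open>The strand in the name of each case passes over the other two, which cross virtually.\<close>

inductive welded_move :: "layers \<Rightarrow> layers \<Rightarrow> bool" where
  W_strand1: "welded_move (triangle i RisingOver RisingOver Virtual)
                          (triangle' i RisingOver RisingOver Virtual)"
| W_strand2: "welded_move (triangle i FallingOver Virtual RisingOver)
                          (triangle' i FallingOver Virtual RisingOver)"
| W_strand3: "welded_move (triangle i Virtual FallingOver FallingOver)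
                          (triangle' i Virtual FallingOver FallingOver)"

definition local_move :: "layers \<Rightarrow> layers \<Rightarrow> bool" where
  "local_move m m' \<longleftrightarrow>
     isotopy_move m m' \<or> classical_move m m' \<or> virtual_move m m' \<or> welded_move m m'"

definition diagram_move :: "layers \<Rightarrow> layers \<Rightarrow> bool" where
  "diagram_move D D' \<longleftrightarrow>
     virtual_link_diagram D \<and> virtual_link_diagram D' \<and>
     (\<exists>u m m' v. D = u @ m @ v \<and> D' = u @ m' @ v \<and> local_move m m')"

definition welded_equivalent :: "layers \<Rightarrow> layers \<Rightarrow> bool" where
  "welded_equivalent D D' \<longleftrightarrow>
     virtual_link_diagram D \<and> virtual_link_diagram D' \<and> equivclp diagram_move D D'"

text \<open>
  The parallel diagrams. A strand at position \<open>i\<close> is replaced by copies at positions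
  \<open>2 * i\<close> and \<open>2 * i + 1\<close>. From left to right in the plane these are the L and R copies if the
  strand is oriented upwards, and the R and L copies if it is oriented downwards. In the following,
  \<open>f d\<close> is the orientation of the L copy of a strand of orientation \<open>d\<close>; the R copy has
  orientation \<open>d\<close>.
\<close>

text \<open>
  Four crossings by which the pair of copies of the rising strand crosses that of the falling
  strand. Here \<open>k j j'\<close> is the kind of the crossing of the \<open>j\<close>-th rising with the \<open>j'\<close>-th falling
  strand, numbered 0, 1 from left to right.
\<close>

definition pairs_crossing :: "nat \<Rightarrow> (nat \<Rightarrow> nat \<Rightarrow> crossing) \<Rightarrow> layers" where
  "pairs_crossing i k =
     [(2 * i + 1, Cross (k 1 0)), (2 * i, Cross (k 0 0)),
      (2 * i + 2, Cross (k 1 1)), (2 * i + 1, Cross (k 0 1))]"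

definition is_R_copy :: "orientation \<Rightarrow> nat \<Rightarrow> bool" where
  "is_R_copy d j \<longleftrightarrow> (if d = Up then j = 1 else j = 0)"

text \<open>
  Sign of a classical crossing whose rising and falling strands have orientations \<open>d\<close> and \<open>e\<close>.
\<close>

definition positive :: "crossing \<Rightarrow> orientation \<Rightarrow> orientation \<Rightarrow> bool" where
  "positive c d e \<longleftrightarrow> (c = RisingOver \<and> d = e) \<or> (c = FallingOver \<and> d \<noteq> e)"

text \<open>
  The twists, on the pair at positions \<open>j\<close> and \<open>j + 1\<close> of copies of a strand of orientation \<open>d\<close>.
  The order of the layers is from bottom to top, which is the order along the strand only if it is
  oriented upwards. In both cases R is over L.
\<close>

fun twist_minus1_v :: "nat \<Rightarrow> orientation \<Rightarrow> layers" where
  "twist_minus1_v j Up = [(j, Cross FallingOver), (j, Cross Virtual)]"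
| "twist_minus1_v j Down = [(j, Cross Virtual), (j, Cross FallingOver)]"

fun twist_v_1 :: "nat \<Rightarrow> orientation \<Rightarrow> layers" where
  "twist_v_1 j Up = [(j, Cross Virtual), (j, Cross RisingOver)]"
| "twist_v_1 j Down = [(j, Cross RisingOver), (j, Cross Virtual)]"

text \<open>
  Inserts the twist of an under strand of orientation \<open>e\<close>: after the crossing along the strand, at
  a positive crossing, and before it, at a negative one. The pair of copies of the under strand
  is at position \<open>jb\<close> below the crossing and at position \<open>jt\<close> above it.
\<close>

definition add_twist :: "bool \<Rightarrow> orientation \<Rightarrow> nat \<Rightarrow> nat \<Rightarrow> layers \<Rightarrow> layers" where
  "add_twist pos e jb jt w =
     (if pos then (if e = Up then w @ twist_minus1_v jt e else twist_minus1_v jb e @ w)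
      else (if e = Up then twist_v_1 jb e @ w else w @ twist_v_1 jt e))"

fun parallel_crossing :: "nat \<Rightarrow> crossing \<Rightarrow> orientation \<Rightarrow> orientation \<Rightarrow> layers" where
  "parallel_crossing i Virtual d e = pairs_crossing i (\<lambda>j j'. Virtual)"
| "parallel_crossing i RisingOver d e =
     add_twist (positive RisingOver d e) e (2 * i + 2) (2 * i)
       (pairs_crossing i (\<lambda>j j'. if is_R_copy d j then RisingOver else Virtual))"
| "parallel_crossing i FallingOver d e =
     add_twist (positive FallingOver d e) d (2 * i) (2 * i + 2)
       (pairs_crossing i (\<lambda>j j'. if is_R_copy e j' then FallingOver else Virtual))"

fun parallel_layer ::
  "(orientation \<Rightarrow> orientation) \<Rightarrow> layer \<Rightarrow> orientation list \<Rightarrow> layers" where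
  "parallel_layer f (i, Cup Up) s = [(2 * i, Cup (f Up)), (2 * i + 1, Cup Up)]"
| "parallel_layer f (i, Cup Down) s = [(2 * i, Cup Down), (2 * i + 1, Cup (f Down))]"
| "parallel_layer f (i, Cap) s = [(2 * i + 1, Cap), (2 * i, Cap)]"
| "parallel_layer f (i, Cross c) s = parallel_crossing i c (s ! i) (s ! (i + 1))"

fun parallel_layers ::
  "(orientation \<Rightarrow> orientation) \<Rightarrow> layers \<Rightarrow> orientation list \<Rightarrow> layers" where
  "parallel_layers f [] s = []"
| "parallel_layers f (l # w) s =
     parallel_layer f l s @ parallel_layers f w (the (layer_top l s))"

definition phi_plus :: "layers \<Rightarrow> layers" where
  "phi_plus D = parallel_layers (\<lambda>d. d) D []"

definition phi_minus :: "layers \<Rightarrow> layers" where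
  "phi_minus D = parallel_layers opp D []"

end

theory Submission
  imports Defs
begin

text \<open>
  At a classical crossing only the R copy of the over strand is seen by the under pair; the L copy
  crosses everything virtually. So, up to the twist, the over pair consists of an over strand and a
  virtual strand, both of which slide across any word of crossings, by R3, the mixed moves and the
  welded move. The twist itself passes through a crossing of pairs along either pair: along the
  under pair by the same sliding, and along the over pair because R then passes over both L and the
  under strand, which cross each other virtually. Hence the twist may be put before or after its
  crossing, R2 becomes trivial, and a triangle move in which the first strand is over or virtual
  follows by sliding; R2 turns every other triangle move into one of these. A doubled kink reduces by
  two R1 moves and one triangle move to two crossings of R and L, which the twist cancels.
\<close>

section \<open>Equivalence of tangles\<close>

text \<open>Doubling is not a letterwise substitution: the parallel of a crossing depends on the
  orientations of its strands, so a move has to be treated together with the list of orientations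
  below it. Reversing the left copies, in contrast, affects the layers only at minima, since
  \<open>f\<close> enters no parallel crossing. One argument therefore serves
  \<open>phi_plus\<close> and \<open>phi_minus\<close>, with \<open>f\<close> any map that commutes
  with \<open>opp\<close>. Identities without minima and maxima are computed on words of crossings,
  as in a braid group; there orientations only decide which copy is R and which twist occurs. Kinks
  and planar isotopies are treated as oriented tangles. The origin of the twist is the kink: once
  their self-crossings are removed, the two copies of a classical kink still cross each other twice,
  once with R over L and once virtually. The sign rule makes the inserted twist the inverse of this
  word, and it also makes the twists of the two crossings of a classical bigon inverse to each
  other.\<close>

definition shift :: "nat \<Rightarrow> layers \<Rightarrow> layers" where
  "shift k = map (\<lambda>(i, p). (k + i, p))"

lemma shift_simps [simp]:
  "shift k [] = []"
  "shift k ((i, p) # w) = (k + i, p) # shift k w"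
  "shift k (u @ v) = shift k u @ shift k v"
  "length (shift k w) = length w"
  by (simp_all add: shift_def)

lemma shift_0 [simp]: "shift 0 w = w"
  by (simp add: shift_def case_prod_beta)

lemma shift_shift [simp]: "shift k (shift l w) = shift (k + l) w"
  by (simp add: shift_def case_prod_beta add.assoc comp_def)

section \<open>Stacking tangles and placing them between further strands\<close>

lemma layers_top_append:
  "layers_top (u @ v) s = Option.bind (layers_top u s) (layers_top v)"
  by (induction u arbitrary: s) (auto split: bind_splits)

lemma layer_top_frame:
  "layer_top (i, p) s = Some t \<Longrightarrow>
   layer_top (length a + i, p) (a @ s @ b) = Some (a @ t @ b)"
  by (cases p) (auto simp: nth_append add.assoc split: if_splits)

lemma layers_top_frame:
  "layers_top w s = Some t \<Longrightarrow>
   layers_top (shift (length a) w) (a @ s @ b) = Some (a @ t @ b)"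
proof (induction w arbitrary: s)
  case (Cons l w)
  obtain i p where l: "l = (i, p)" by (cases l)
  from Cons.prems obtain r where r: "layer_top (i, p) s = Some r" "layers_top w r = Some t"
    by (auto simp: l bind_eq_Some_conv)
  then show ?case using layer_top_frame[OF r(1), of a b] Cons.IH[OF r(2)] by (simp add: l)
qed simp

lemma layer_top_length:
  "layer_top (i, p) s = Some t \<Longrightarrow>
   i + strands_below p \<le> length s \<and> length t + strands_below p = length s + strands_above p"
  by (cases p) (auto split: if_splits)

lemma shift_patterns:
  "shift k (kink_right i d c) = kink_right (k + i) d c"
  "shift k (kink_left i d c) = kink_left (k + i) d c"
  "shift k (bigon i c) = bigon (k + i) c"
  "shift k (triangle i x y z) = triangle (k + i) x y z"
  "shift k (triangle' i x y z) = triangle' (k + i) x y z"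
  by (simp_all add: kink_right_def kink_left_def bigon_def triangle_def triangle'_def)

lemma local_move_shift:
  "local_move m m' \<Longrightarrow> local_move (shift k m) (shift k m')"
proof -
  have iso: "isotopy_move m m' \<Longrightarrow> isotopy_move (shift k m) (shift k m')"
  proof (induction rule: isotopy_move.induct)
    case (exchange i p j q)
    show ?case using isotopy_move.exchange[of "k + i" p j q] by (simp add: add_ac)
  next
    case (straighten_left i d)
    show ?case using isotopy_move.straighten_left[of "k + i"] by simp
  next
    case (straighten_right i d)
    show ?case using isotopy_move.straighten_right[of "k + i"] by simp
  next
    case (cap_through i c)
    show ?case using isotopy_move.cap_through[of "k + i"] by simp
  next
    case (cup_through i d c)
    show ?case using isotopy_move.cup_through[of "k + i"] by simp
  qed
  have cl: "classical_move m m' \<Longrightarrow> classical_move (shift k m) (shift k m')"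
    by (induction rule: classical_move.induct)
      (auto simp: shift_patterns intro: classical_move.intros)
  have vi: "virtual_move m m' \<Longrightarrow> virtual_move (shift k m) (shift k m')"
    by (induction rule: virtual_move.induct)
      (auto simp: shift_patterns intro: virtual_move.intros)
  have we: "welded_move m m' \<Longrightarrow> welded_move (shift k m) (shift k m')"
    by (induction rule: welded_move.induct)
      (simp_all only: shift_patterns welded_move.intros)
  show "local_move m m' \<Longrightarrow> local_move (shift k m) (shift k m')"
    using iso cl vi we unfolding local_move_def by blast
qed

text \<open>Whether a move fits depends on the orientations below it, hence the index
  \<open>s\<close>. The rule \<open>above\<close> puts the change over a fixed \<open>u\<close>,
  after which the orientations have become \<open>t\<close>; \<open>below\<close> puts it under a
  fixed \<open>v\<close>. Equivalent words have the same top, so \<open>v\<close> fits both of them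
  or neither.\<close>

inductive tangle_eq :: "orientation list \<Rightarrow> layers \<Rightarrow> layers \<Rightarrow> bool" where
  move: "\<lbrakk>local_move m m'; layers_top m s = Some t; layers_top m' s = Some t\<rbrakk> \<Longrightarrow> tangle_eq s m m'"
| refl: "tangle_eq s w w"
| sym: "tangle_eq s w w' \<Longrightarrow> tangle_eq s w' w"
| trans [trans]: "\<lbrakk>tangle_eq s w w'; tangle_eq s w' w''\<rbrakk> \<Longrightarrow> tangle_eq s w w''"
| above: "\<lbrakk>layers_top u s = Some t; tangle_eq t w w'\<rbrakk> \<Longrightarrow> tangle_eq s (u @ w) (u @ w')"
| below: "tangle_eq s w w' \<Longrightarrow> tangle_eq s (w @ v) (w' @ v)"

lemma tangle_eq_top: "tangle_eq s w w' \<Longrightarrow> layers_top w s = layers_top w' s"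
  by (induction rule: tangle_eq.induct) (auto simp: layers_top_append)

text \<open>The context \<open>u\<close>, \<open>v\<close> is generalized because the fixed word of
  \<open>above\<close> is absorbed into \<open>u\<close> and that of \<open>below\<close> into
  \<open>v\<close>. That the intermediate words are again closed diagrams comes from
  \<open>tangle_eq_top\<close>.\<close>

lemma tangle_eq_imp_diagram_moves:
  "\<lbrakk>tangle_eq s w w'; layers_top u [] = Some s; virtual_link_diagram (u @ w @ v)\<rbrakk> \<Longrightarrow>
   equivclp diagram_move (u @ w @ v) (u @ w' @ v)"
proof (induction arbitrary: u v rule: tangle_eq.induct)
  case (move m m' s t)
  then have "diagram_move (u @ m @ v) (u @ m' @ v)"
    unfolding diagram_move_def
    by (auto simp: virtual_link_diagram_def layers_top_append)
  then show ?case by (rule r_into_equivclp)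
next
  case (refl s w)
  show ?case by (rule equivclp_refl)
next
  case (sym s w w')
  from sym.prems tangle_eq_top[OF sym.hyps] have "virtual_link_diagram (u @ w @ v)"
    by (simp add: virtual_link_diagram_def layers_top_append)
  with sym show ?case by (blast intro: equivclp_sym)
next
  case (trans s w w' w'')
  from trans.prems tangle_eq_top[OF trans.hyps(1)] have "virtual_link_diagram (u @ w' @ v)"
    by (simp add: virtual_link_diagram_def layers_top_append)
  with trans show ?case by (blast intro: equivclp_trans)
next
  case (above u' s t w w')
  then show ?case using above.IH[of "u @ u'" v] by (simp add: layers_top_append)
next
  case (below s w w' v')
  then show ?case using below.IH[of u "v' @ v"] by simp
qed

lemma tangle_eq_imp_welded_equivalent:
  assumes "tangle_eq [] D D'" "virtual_link_diagram D"
  shows "welded_equivalent D D'"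
  using tangle_eq_imp_diagram_moves[OF assms(1), of "[]" "[]"] tangle_eq_top[OF assms(1)] assms(2)
  by (simp add: welded_equivalent_def virtual_link_diagram_def)

lemma tangle_eq_frame:
  "tangle_eq s w w' \<Longrightarrow> tangle_eq (a @ s @ b) (shift (length a) w) (shift (length a) w')"
proof (induction rule: tangle_eq.induct)
  case (move m m' s t)
  then show ?case
    by (meson layers_top_frame local_move_shift tangle_eq.move)
next
  case (above u s t w w')
  then show ?case using layers_top_frame[of u s t] by (auto intro: tangle_eq.above)
qed (auto intro: tangle_eq.intros)

text \<open>The letters \<open>j\<close>, \<open>n\<close>, \<open>n'\<close> locate the move: \<open>n\<close> layers above the first \<open>j\<close> are replaced by \<open>n'\<close>.\<close>

lemma tangle_eq_step:
  assumes "local_move (take n (drop j w)) (take n' (drop j w')) \<or>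
           local_move (take n' (drop j w')) (take n (drop j w))"
    and "take j w = take j w'" "drop (j + n) w = drop (j + n') w'"
    and "case layers_top (take j w) s of
           None \<Rightarrow> False
         | Some t \<Rightarrow> layers_top (take n (drop j w)) t \<noteq> None \<and>
                    layers_top (take n' (drop j w')) t = layers_top (take n (drop j w)) t"
  shows "tangle_eq s w w'"
proof -
  obtain t r where t: "layers_top (take j w) s = Some t"
    and r: "layers_top (take n (drop j w)) t = Some r" "layers_top (take n' (drop j w')) t = Some r"
    using assms(4) by (auto split: option.splits)
  have "tangle_eq t (take n (drop j w)) (take n' (drop j w'))"
    using assms(1) r by (auto intro: tangle_eq.move tangle_eq.sym)
  then have "tangle_eq s (take j w @ take n (drop j w) @ drop (j + n) w)
                        (take j w @ take n' (drop j w') @ drop (j + n) w)"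
    by (rule tangle_eq.above[OF t tangle_eq.below])
  moreover have "take n (drop j w) @ drop (j + n) w = drop j w"
    by (metis append_take_drop_id drop_drop add.commute)
  moreover have "take n' (drop j w') @ drop (j + n) w = drop j w'"
    by (metis append_take_drop_id assms(3) drop_drop add.commute)
  ultimately show ?thesis using assms(2) by (metis append_take_drop_id)
qed

text \<open>The sums in the rule \<open>exchange\<close> become (in)equations, so that it matches
  numerals and simplification settles the arithmetic. The second premise says how the position of
  \<open>q\<close> changes when \<open>q\<close> is moved below \<open>p\<close>.\<close>

lemma local_exchange:
  assumes "i + strands_above p \<le> j" "j' + strands_above p = j + strands_below p"
  shows "local_move [(i, p), (j, q)] [(j', q), (i, p)]"
proof -
  obtain k where "j = i + strands_above p + k" using assms(1) le_Suc_ex by blast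
  with assms(2) show ?thesis
    using isotopy_move.exchange[of i p k q] by (simp add: local_move_def add_ac)
qed

text \<open>Two tangles side by side, with the strands \<open>m\<close> between them, change heights
  one pair of pieces at a time.\<close>

lemma tangle_eq_exchange:
  assumes "layers_top u a = Some a'" "layers_top v b = Some b'"
  shows "tangle_eq (a @ m @ b) (u @ shift (length a' + length m) v)
           (shift (length a + length m) v @ u)"
proof -
  \<comment> \<open>A single piece against a single piece; \<open>many\<close> extends this to a
    word on the right, the final induction to a word on the left.\<close>
  have one: "tangle_eq (a @ m @ b) [(i, p), (length a' + length m + j, q)]
              [(length a + length m + j, q), (i, p)]"
    if "layer_top (i, p) a = Some a'" "layer_top (j, q) b = Some b'" for i p j q a a' b b'
  proof (rule tangle_eq.move)
    show "local_move [(i, p), (length a' + length m + j, q)] [(length a + length m + j, q), (i, p)]"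
      using layer_top_length[OF that(1)] by (intro local_exchange) auto
    show "layers_top [(i, p), (length a' + length m + j, q)] (a @ m @ b) = Some (a' @ m @ b')"
      using layer_top_frame[OF that(1), of "[]" "m @ b"]
        layer_top_frame[OF that(2), of "a' @ m" "[]"] by simp
    show "layers_top [(length a + length m + j, q), (i, p)] (a @ m @ b) = Some (a' @ m @ b')"
      using layer_top_frame[OF that(1), of "[]" "m @ b'"]
        layer_top_frame[OF that(2), of "a @ m" "[]"] by simp
  qed
  have many: "tangle_eq (a @ m @ b) ((i, p) # shift (length a' + length m) v)
              (shift (length a + length m) v @ [(i, p)])"
    if "layer_top (i, p) a = Some a'" "layers_top v b = Some b'" for i p v a a' b b'
    using that(2)
  proof (induction v arbitrary: b)
    case Nil
    then show ?case by (simp add: tangle_eq.refl)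
  next
    case (Cons l v)
    obtain j q where l: "l = (j, q)" by (cases l)
    from Cons.prems obtain r where r: "layer_top (j, q) b = Some r" "layers_top v r = Some b'"
      by (auto simp: l bind_eq_Some_conv)
    have "tangle_eq (a @ m @ b)
       ([(i, p), (length a' + length m + j, q)] @ shift (length a' + length m) v)
       ([(length a + length m + j, q), (i, p)] @ shift (length a' + length m) v)"
      by (rule tangle_eq.below[OF one[OF that(1) r(1)]])
    also have "[(length a + length m + j, q), (i, p)] @ shift (length a' + length m) v =
       [(length a + length m + j, q)] @ ((i, p) # shift (length a' + length m) v)"
      by simp
    also have "tangle_eq (a @ m @ b)
       ([(length a + length m + j, q)] @ ((i, p) # shift (length a' + length m) v))
       ([(length a + length m + j, q)] @ (shift (length a + length m) v @ [(i, p)]))"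
      using layer_top_frame[OF r(1), of "a @ m" "[]"]
      by (intro tangle_eq.above[of _ _ "a @ m @ r"] Cons.IH r(2)) (simp add: add.assoc)
    finally show ?case by (simp add: l add.assoc)
  qed
  show ?thesis
    using assms(1)
  proof (induction u arbitrary: a)
    case Nil
    then show ?case by (simp add: tangle_eq.refl)
  next
    case (Cons l u)
    obtain i p where l: "l = (i, p)" by (cases l)
    from Cons.prems obtain r where r: "layer_top (i, p) a = Some r" "layers_top u r = Some a'"
      by (auto simp: l bind_eq_Some_conv)
    have "tangle_eq (a @ m @ b)
       ([(i, p)] @ (u @ shift (length a' + length m) v))
       ([(i, p)] @ (shift (length r + length m) v @ u))"
      using layer_top_frame[OF r(1), of "[]" "m @ b"]
      by (intro tangle_eq.above[of _ _ "r @ m @ b"] Cons.IH r(2)) (simp add: add.assoc)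
    also have "[(i, p)] @ (shift (length r + length m) v @ u) =
       ((i, p) # shift (length r + length m) v) @ u"
      by simp
    also have "tangle_eq (a @ m @ b) (((i, p) # shift (length r + length m) v) @ u)
       ((shift (length a + length m) v @ [(i, p)]) @ u)"
      by (rule tangle_eq.below[OF many[OF r(1) assms(2)]])
    finally show ?case by (simp add: l)
  qed
qed

section \<open>Equivalence of words of crossings\<close>

lemma flip_flip [simp]: "flip (flip c) = c"
  by (cases c) auto

lemma opp_opp [simp]: "opp (opp d) = d"
  by (cases d) auto

definition triangle_move :: "crossing \<Rightarrow> crossing \<Rightarrow> crossing \<Rightarrow> bool" where
  "triangle_move a b c \<longleftrightarrow> (\<forall>i. local_move (triangle i a b c) (triangle' i a b c))"

lemma R3_levels:
  "\<lbrakk>distinct [x, y, z]; a = crossing_of_levels x y; b = crossing_of_levels x z;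
    c = crossing_of_levels y z\<rbrakk> \<Longrightarrow> triangle_move a b c"
  unfolding triangle_move_def local_move_def using classical_move.R3 by blast

text \<open>Strand 1 passes over both others or meets both virtually, while their crossing is
  arbitrary: this is R3 or the welded move in the first case, virtual III or the mixed move in the
  second. Sliding a pair across arbitrary words rests on it.\<close>

lemma triangle_move_over:
  assumes "k \<noteq> FallingOver" shows "triangle_move k k c"
proof (cases k)
  case RisingOver
  show ?thesis
  proof (cases c)
    \<comment> \<open>Strand 1 gets level 2; the levels of strands 2 and 3 are chosen to realise
      \<open>c\<close>.\<close>
    case RisingOver
    then show ?thesis using \<open>k = RisingOver\<close>
      by (intro R3_levels[of 2 1 0]) (auto simp: crossing_of_levels_def)
  next
    case FallingOver
    then show ?thesis using \<open>k = RisingOver\<close>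
      by (intro R3_levels[of 2 0 1]) (auto simp: crossing_of_levels_def)
  next
    case Virtual
    then show ?thesis using \<open>k = RisingOver\<close>
      by (auto simp: triangle_move_def local_move_def welded_move.intros)
  qed
next
  case Virtual
  then show ?thesis
    by (cases "c = Virtual") (auto simp: triangle_move_def local_move_def virtual_move.intros)
qed (use assms in simp)

text \<open>Strand 2, respectively 3, is the one that passes over; together with
  \<open>triangle_move_over\<close> this covers all positions of the over strand in the welded
  move.\<close>

lemma triangle_move_under_over:
  "triangle_move FallingOver Virtual RisingOver"
  "triangle_move Virtual FallingOver FallingOver"
  by (auto simp: triangle_move_def local_move_def welded_move.intros)

text \<open>Strand 2, respectively 3, is the virtual one.\<close>

lemma triangle_move_virtual_strand:
  "triangle_move Virtual b Virtual" "triangle_move a Virtual Virtual"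
proof -
  show "triangle_move Virtual b Virtual"
    by (cases "b = Virtual") (auto simp: triangle_move_def local_move_def virtual_move.intros)
  show "triangle_move a Virtual Virtual"
    by (cases "a = Virtual") (auto simp: triangle_move_def local_move_def virtual_move.intros)
qed

text \<open>Equal positions appear as separate variables tied by equations, so that the rules unify
  with words whose positions are numerals of different shapes.\<close>

inductive braid_move :: "nat \<Rightarrow> layers \<Rightarrow> layers \<Rightarrow> bool" for n where
  bigon: "\<lbrakk>i + 1 < n; j = i; c' = flip c\<rbrakk> \<Longrightarrow> braid_move n [(i, Cross c), (j, Cross c')] []"
| far: "\<lbrakk>i + 1 < j; j + 1 < n; i' = i; j' = j\<rbrakk> \<Longrightarrow>
    braid_move n [(i, Cross c), (j, Cross c')] [(j', Cross c'), (i', Cross c)]"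
| triangle: "\<lbrakk>i + 2 < n; j = i + 1; i' = i; i'' = i; j' = j; j'' = j; triangle_move a b c\<rbrakk> \<Longrightarrow>
    braid_move n [(i, Cross a), (j, Cross b), (i', Cross c)]
      [(j', Cross c), (i'', Cross b), (j'', Cross a)]"

text \<open>
  Unlike in \<^const>\<open>tangle_eq\<close>, the words around a move are arbitrary, so that they never have to be
  checked to fit \<open>n\<close> strands: equivalence preserves fitting.
\<close>

inductive braid_eq :: "nat \<Rightarrow> layers \<Rightarrow> layers \<Rightarrow> bool" for n where
  move: "braid_move n m m' \<Longrightarrow> braid_eq n m m'"
| refl: "braid_eq n w w"
| sym: "braid_eq n w w' \<Longrightarrow> braid_eq n w' w"
| trans [trans]: "\<lbrakk>braid_eq n w w'; braid_eq n w' w''\<rbrakk> \<Longrightarrow> braid_eq n w w''"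
| cong: "braid_eq n w w' \<Longrightarrow> braid_eq n (u @ w @ v) (u @ w' @ v)"

text \<open>As in \<open>tangle_eq_step\<close>, the numbers \<open>j\<close>, \<open>l\<close>,
  \<open>l'\<close> locate the rewritten block, here without any orientations to check.\<close>

lemma braid_eq_step:
  assumes "braid_move n (take l (drop j w)) (take l' (drop j w')) \<or>
           braid_move n (take l' (drop j w')) (take l (drop j w))"
    and "take j w = take j w'" "drop (j + l) w = drop (j + l') w'"
  shows "braid_eq n w w'"
proof -
  have "braid_eq n (take l (drop j w)) (take l' (drop j w'))"
    using assms(1) by (auto intro: braid_eq.move braid_eq.sym)
  then have "braid_eq n (take j w @ take l (drop j w) @ drop (j + l) w)
                        (take j w @ take l' (drop j w') @ drop (j + l) w)"
    by (rule braid_eq.cong)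
  moreover have "take l (drop j w) @ drop (j + l) w = drop j w"
    by (metis append_take_drop_id drop_drop add.commute)
  moreover have "take l' (drop j w') @ drop (j + l) w = drop j w'"
    by (metis append_take_drop_id assms(3) drop_drop add.commute)
  ultimately show ?thesis using assms(2) by (metis append_take_drop_id)
qed

text \<open>The decomposition into context and changed block is left as equations, for
  simplification to prove modulo associativity.\<close>

lemma braid_eq_in:
  "\<lbrakk>braid_eq n m m'; w = u @ m @ v; w' = u @ m' @ v\<rbrakk> \<Longrightarrow> braid_eq n w w'"
  by (simp add: braid_eq.cong)

lemma braid_eq_append:
  "\<lbrakk>braid_eq n u u'; braid_eq n v v'\<rbrakk> \<Longrightarrow> braid_eq n (u @ v) (u' @ v')"
  using braid_eq.cong[of n u u' "[]" v] braid_eq.cong[of n v v' u' "[]"]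
  by (auto intro: braid_eq.trans)

lemma braid_move_shift:
  "\<lbrakk>braid_move n w w'; k + n \<le> n'\<rbrakk> \<Longrightarrow> braid_move n' (shift k w) (shift k w')"
  by (induction rule: braid_move.induct) (auto intro!: braid_move.intros)

lemma braid_eq_shift:
  "\<lbrakk>braid_eq n w w'; k + n \<le> n'\<rbrakk> \<Longrightarrow> braid_eq n' (shift k w) (shift k w')"
proof (induction rule: braid_eq.induct)
  case (move m m')
  then show ?case by (blast intro: braid_eq.move braid_move_shift)
qed (auto intro: braid_eq.intros)

lemma braid_eq_mono: "\<lbrakk>braid_eq n w w'; n \<le> n'\<rbrakk> \<Longrightarrow> braid_eq n' w w'"
  using braid_eq_shift[of n w w' 0 n'] by simp

section \<open>From words of crossings to tangles\<close>

fun crossing_below :: "nat \<Rightarrow> layer \<Rightarrow> bool" where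
  "crossing_below n (i, Cross c) \<longleftrightarrow> i + 1 < n"
| "crossing_below n (i, _) \<longleftrightarrow> False"

lemma layers_top_crossings:
  assumes "list_all (crossing_below (length s)) w"
  obtains t where "layers_top w s = Some t" "length t = length s"
  using assms
proof (induction w arbitrary: s thesis)
  case (Cons l w)
  then obtain i c where l: "l = (i, Cross c)" "i + 1 < length s"
    by (cases "(length s, l)" rule: crossing_below.cases) auto
  define r where "r = take i s @ [s ! (i + 1), s ! i] @ drop (i + 2) s"
  have "length r = length s" using l(2) by (simp add: r_def)
  with Cons.prems(2) obtain t where "layers_top w r = Some t" "length t = length r"
    using Cons.IH[of r] by auto
  moreover have "layer_top l s = Some r" using l by (simp add: r_def)
  ultimately show ?case using Cons.prems(1) \<open>length r = length s\<close> by simp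
qed simp

lemma braid_move_imp_local_move:
  assumes "braid_move n m m'"
  shows "local_move m m' \<or> local_move m' m"
  using assms
proof cases
  case (bigon i j c' c)
  then show ?thesis
    unfolding local_move_def using classical_move.R2[of c i] virtual_move.V2[of i]
    by (cases "c = Virtual") (auto simp: bigon_def)
next
  case (far i j i' j' c c')
  then show ?thesis using local_exchange[of i "Cross c" j j "Cross c'"] by simp
next
  case (triangle i j i' i'' j' j'' a b c)
  then show ?thesis by (simp add: triangle_move_def triangle_def triangle'_def)
qed

lemma braid_move_crossings:
  "braid_move n m m' \<Longrightarrow> list_all (crossing_below n) m \<and> list_all (crossing_below n) m'"
  by (cases rule: braid_move.cases) auto

lemma split_two:
  assumes "i + 1 < length s"
  shows "s = take i s @ [s ! i, s ! (i + 1)] @ drop (i + 2) s"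
proof -
  have "s ! i # s ! (i + 1) # drop (i + 2) s = drop i s"
    using assms by (simp add: Cons_nth_drop_Suc)
  then show ?thesis by simp
qed

text \<open>A crossing transposes two entries; written as list updates, the two sides of a relation
  can be compared entry by entry.\<close>

lemma swap_eq_update:
  assumes "i + 1 < length s"
  shows "take i s @ [s ! (i + 1), s ! i] @ drop (i + 2) s = s[i := s ! (i + 1), i + 1 := s ! i]"
proof -
  have "(take i s @ [s ! i, s ! (i + 1)] @ drop (i + 2) s)[i := x, i + 1 := y] =
      take i s @ [x, y] @ drop (i + 2) s" for x y
    using assms by (simp add: list_update_append)
  then show ?thesis using split_two[OF assms] by metis
qed

text \<open>On orientations the three relations are those of adjacent transpositions.\<close>

lemma braid_move_top:
  assumes "braid_move n m m'" "length s = n"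
  shows "layers_top m s = layers_top m' s"
proof -
  have swap: "layer_top (i, Cross c) s = (if i + 1 < length s then
      Some (s[i := s ! (i + 1), i + 1 := s ! i]) else None)" for i c s
    using swap_eq_update[of i s] by simp
  show ?thesis
    using assms
    by (cases rule: braid_move.cases)
      (auto simp: swap simp del: layer_top.simps intro!: nth_equalityI simp: nth_list_update)
qed

lemma braid_eq_crossings:
  "braid_eq n w w' \<Longrightarrow> list_all (crossing_below n) w \<longleftrightarrow> list_all (crossing_below n) w'"
  by (induction rule: braid_eq.induct) (auto dest: braid_move_crossings)

text \<open>Fitting is checked once, for \<open>w\<close>: \<open>braid_eq_crossings\<close> passes
  it to every intermediate word, and a word of crossings within the given strands fits all
  orientations.\<close>

lemma braid_eq_imp_tangle_eq:
  "\<lbrakk>braid_eq n w w'; list_all (crossing_below n) w; length s = n\<rbrakk> \<Longrightarrow> tangle_eq s w w'"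
proof (induction arbitrary: s rule: braid_eq.induct)
  case (move m m')
  then obtain t where "layers_top m s = Some t"
    using layers_top_crossings by metis
  then show ?case
    using braid_move_imp_local_move[OF move.hyps] braid_move_top[OF move.hyps]
      move.prems by (metis tangle_eq.move tangle_eq.sym)
next
  case (cong w w' u v)
  then obtain t where "layers_top u s = Some t" "length t = length s"
    using layers_top_crossings by (metis list_all_append)
  with cong show ?case by (auto intro: tangle_eq.above tangle_eq.below)
qed (auto intro: tangle_eq.intros simp: braid_eq_crossings)

section \<open>Pairs of strands crossing each other\<close>

text \<open>The order is that of \<open>pairs_crossing\<close>: right rising with left falling
  strand, left with left, right with right, left with right. Thus \<open>a\<close>, \<open>c\<close>
  belong to the right rising strand and \<open>b\<close>, \<open>d\<close> to the left one;
  \<open>a\<close>, \<open>b\<close> belong to the left falling strand and \<open>c\<close>,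
  \<open>d\<close> to the right one.\<close>

abbreviation "pair_word a b c d \<equiv> [(1, Cross a), (0, Cross b), (2, Cross c), (1, Cross d)]"

text \<open>A parallel crossing before its twist is inserted. For a classical crossing,
  \<open>d\<close> is the orientation of the over strand, which decides which of its copies is
  R.\<close>

definition over_crossing :: "crossing \<Rightarrow> orientation \<Rightarrow> layers" where
  "over_crossing c d =
     pairs_crossing 0 (\<lambda>j j'. if is_R_copy d (if c = RisingOver then j else j') then c else Virtual)"

text \<open>\<open>pos\<close> is the sign of the crossing to which the twist belongs.\<close>

definition twist :: "bool \<Rightarrow> orientation \<Rightarrow> nat \<Rightarrow> layers" where
  "twist pos d j = (if pos then twist_minus1_v j d else twist_v_1 j d)"

lemma over_crossing_simps [simp]:
  "over_crossing RisingOver Up = pair_word RisingOver Virtual RisingOver Virtual"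
  "over_crossing RisingOver Down = pair_word Virtual RisingOver Virtual RisingOver"
  "over_crossing FallingOver Up = pair_word Virtual Virtual FallingOver FallingOver"
  "over_crossing FallingOver Down = pair_word FallingOver FallingOver Virtual Virtual"
  "over_crossing Virtual d = pair_word Virtual Virtual Virtual Virtual"
  by (simp_all add: over_crossing_def pairs_crossing_def is_R_copy_def)

lemma twist_simps [simp]:
  "twist True Up j = [(j, Cross FallingOver), (j, Cross Virtual)]"
  "twist True Down j = [(j, Cross Virtual), (j, Cross FallingOver)]"
  "twist False Up j = [(j, Cross Virtual), (j, Cross RisingOver)]"
  "twist False Down j = [(j, Cross RisingOver), (j, Cross Virtual)]"
  by (simp_all add: twist_def)

lemma twist_shift: "shift k (twist p d j) = twist p d (k + j)"
  by (cases p; cases d) simp_all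

text \<open>Each twist is the other one reversed with its crossings flipped, so two bigons
  cancel.\<close>

lemma twist_inverse:
  assumes "j + 1 < n" shows "braid_eq n (twist p d j @ twist (\<not> p) d j) []"
proof -
  have "braid_eq n [(j, Cross a), (j, Cross b), (j, Cross (flip b)), (j, Cross (flip a))] []" for a b
  proof -
    have "braid_eq n [(j, Cross a), (j, Cross b), (j, Cross (flip b)), (j, Cross (flip a))]
      [(j, Cross a), (j, Cross (flip a))]"
      by (rule braid_eq_step[of _ 2 1 _ 0]) (use assms in \<open>simp_all add: braid_move.bigon\<close>)
    also have "braid_eq n \<dots> []"
      by (rule braid_eq_step[of _ 2 0 _ 0]) (use assms in \<open>simp_all add: braid_move.bigon\<close>)
    finally show ?thesis .
  qed
  from this[of FallingOver Virtual] this[of Virtual RisingOver]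
    this[of Virtual FallingOver] this[of RisingOver Virtual]
  show ?thesis by (cases p; cases d) simp_all
qed

text \<open>If \<open>p\<close> carries \<open>a'\<close> to \<open>b'\<close>, it carries their
  inverses \<open>a\<close> and \<open>b\<close> to each other. This reduces negative twists to
  positive ones.\<close>

lemma braid_eq_conjugate:
  assumes "braid_eq n (a @ a') []" "braid_eq n (b' @ b) []" "braid_eq n (a' @ p) (p @ b')"
  shows "braid_eq n (a @ p) (p @ b)"
proof -
  have "braid_eq n (a @ p @ b' @ b) (a @ p)"
    by (rule braid_eq_in[OF assms(2), where u = "a @ p" and v = "[]"]) simp_all
  then have "braid_eq n (a @ p) (a @ p @ b' @ b)" by (rule braid_eq.sym)
  also have "braid_eq n \<dots> (a @ a' @ p @ b)"
    by (rule braid_eq_in[OF braid_eq.sym[OF assms(3)], where u = a and v = b]) simp_all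
  also have "braid_eq n \<dots> (p @ b)"
    by (rule braid_eq_in[OF assms(1), where u = "[]" and v = "p @ b"]) simp_all
  finally show ?thesis .
qed

text \<open>Here the carrier \<open>p\<close> is inverted instead, which reduces crossings with the
  falling pair over to those with the rising pair over.\<close>

lemma braid_eq_conjugate':
  assumes "braid_eq n (p @ q) []" "braid_eq n (q @ p) []" "braid_eq n (a @ p) (p @ b)"
  shows "braid_eq n (q @ a) (b @ q)"
proof -
  have "braid_eq n (q @ a @ p @ q) (q @ a)"
    by (rule braid_eq_in[OF assms(1), where u = "q @ a" and v = "[]"]) simp_all
  then have "braid_eq n (q @ a) (q @ a @ p @ q)" by (rule braid_eq.sym)
  also have "braid_eq n \<dots> (q @ p @ b @ q)"
    by (rule braid_eq_in[OF assms(3), where u = q and v = q]) simp_all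
  also have "braid_eq n \<dots> (b @ q)"
    by (rule braid_eq_in[OF assms(2), where u = "[]" and v = "b @ q"]) simp_all
  finally show ?thesis .
qed

text \<open>Strict inequalities on both sides of \<open>k\<close> make the positions differ by at
  least 2, as \<open>far\<close> requires.\<close>

lemma braid_eq_far:
  assumes far: "list_all (\<lambda>(i, _). i < k) u" "list_all (\<lambda>(i, _). k < i) v"
    and "list_all (crossing_below n) u" "list_all (crossing_below n) v"
  shows "braid_eq n (u @ v) (v @ u)"
proof -
  have one: "braid_eq n ((i, Cross c) # v) (v @ [(i, Cross c)])"
    if "i < k" "list_all (\<lambda>(i, _). k < i) v" "list_all (crossing_below n) v" for i c v
    using that(2,3)
  proof (induction v)
    case Nil
    then show ?case by (simp add: braid_eq.refl)
  next
    case (Cons l v)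
    then obtain j c' where l: "l = (j, Cross c')" "j + 1 < n"
      by (cases "(n, l)" rule: crossing_below.cases) auto
    have "i + 1 < j" using Cons.prems(1) that(1) l by simp
    then have "braid_eq n ([(i, Cross c), l] @ v) ([l, (i, Cross c)] @ v)"
      using braid_eq.cong[of n "[(i, Cross c), l]" "[l, (i, Cross c)]" "[]" v] l
      by (simp add: braid_eq.move braid_move.far)
    moreover have "braid_eq n ([l] @ ((i, Cross c) # v)) ([l] @ (v @ [(i, Cross c)]))"
      using Cons by (intro braid_eq_append braid_eq.refl Cons.IH) auto
    ultimately show ?case by (auto intro: braid_eq.trans)
  qed
  show ?thesis
    using assms(1,3)
  proof (induction u)
    case Nil
    then show ?case by (simp add: braid_eq.refl)
  next
    case (Cons l u)
    then obtain i c where l: "l = (i, Cross c)"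
      by (cases "(n, l)" rule: crossing_below.cases) auto
    have "braid_eq n ([l] @ (u @ v)) ([l] @ (v @ u))"
      using Cons by (intro braid_eq_append braid_eq.refl Cons.IH) auto
    moreover have "braid_eq n ((l # v) @ u) ((v @ [l]) @ u)"
      using Cons.prems(1) far(2) assms(4) l
      by (intro braid_eq_append braid_eq.refl) (auto intro!: one)
    ultimately show ?case by (auto intro: braid_eq.trans)
  qed
qed

lemma twist_letters:
  "list_all (crossing_below n) (twist p d j) \<longleftrightarrow> j + 1 < n"
  "list_all (\<lambda>(i, _). i < k) (twist p d j) \<longleftrightarrow> j < k"
  "list_all (\<lambda>(i, _). k < i) (twist p d j) \<longleftrightarrow> k < j"
  by (cases p; cases d; auto)+

lemma twist_far: "\<lbrakk>i + 1 < j; j + 1 < n\<rbrakk> \<Longrightarrow> braid_eq n (twist p d i @ twist q e j) (twist q e j @ twist p d i)"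
  by (rule braid_eq_far[where k = "i + 1"]) (simp_all add: twist_letters)

text \<open>For the same orientation the two twists are equal or inverse to each other.\<close>

lemma twist_commute:
  assumes "j + 1 < n" shows "braid_eq n (twist p d j @ twist q d j) (twist q d j @ twist p d j)"
proof (cases "p = q")
  case False
  then have "q = (\<not> p)" by simp
  then show ?thesis
    using twist_inverse[OF assms, of p d] twist_inverse[OF assms, of "\<not> p" d]
    by (auto intro: braid_eq.intros)
qed (simp add: braid_eq.refl)

text \<open>Each rising strand has one kind with both falling strands, \<open>k0\<close> for the
  left and \<open>k1\<close> for the right rising strand. The crossing \<open>x\<close> of the
  falling strands therefore passes the right and then the left rising strand by one triangle move
  each.\<close>

lemma braid_eq_over_crossings:
  assumes "k1 \<noteq> FallingOver" "k0 \<noteq> FallingOver"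
  shows "braid_eq 4 ([(2, Cross x)] @ pair_word k1 k0 k1 k0) (pair_word k1 k0 k1 k0 @ [(0, Cross x)])"
proof -
  have "braid_eq 4 [(2, Cross x), (1, Cross k1), (0, Cross k0), (2, Cross k1), (1, Cross k0)]
     [(2, Cross x), (1, Cross k1), (2, Cross k1), (0, Cross k0), (1, Cross k0)]"
    by (rule braid_eq_step[of _ 2 2 _ 2]) (simp_all add: braid_move.far)
  also have "braid_eq 4 \<dots>
     [(1, Cross k1), (2, Cross k1), (1, Cross x), (0, Cross k0), (1, Cross k0)]"
    by (rule braid_eq_step[of _ 3 0 _ 3])
      (simp_all add: braid_move.triangle triangle_move_over assms)
  also have "braid_eq 4 \<dots>
     [(1, Cross k1), (2, Cross k1), (0, Cross k0), (1, Cross k0), (0, Cross x)]"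
    by (rule braid_eq_step[of _ 3 2 _ 3])
      (simp_all add: braid_move.triangle triangle_move_over assms)
  also have "braid_eq 4 \<dots>
     [(1, Cross k1), (0, Cross k0), (2, Cross k1), (1, Cross k0), (0, Cross x)]"
    by (rule braid_eq_step[of _ 2 1 _ 2]) (simp_all add: braid_move.far)
  finally show ?thesis by simp
qed

text \<open>The second word is the first one read from top to bottom with flipped kinds, up to the
  order of its two far letters.\<close>

lemma pair_word_inverse:
  "braid_eq 4 (pair_word a b c d @ pair_word (flip d) (flip b) (flip c) (flip a)) []"
proof -
  have "braid_eq 4 (pair_word a b c d @ pair_word (flip d) (flip b) (flip c) (flip a))
    [(1, Cross a), (0, Cross b), (2, Cross c), (0, Cross (flip b)), (2, Cross (flip c)), (1, Cross (flip a))]"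
    by (rule braid_eq_step[of _ 2 3 _ 0]) (simp_all add: braid_move.bigon)
  also have "braid_eq 4 \<dots>
    [(1, Cross a), (0, Cross b), (0, Cross (flip b)), (2, Cross c), (2, Cross (flip c)), (1, Cross (flip a))]"
    by (rule braid_eq_step[of _ 2 2 _ 2]) (simp_all add: braid_move.far)
  also have "braid_eq 4 \<dots> [(1, Cross a), (2, Cross c), (2, Cross (flip c)), (1, Cross (flip a))]"
    by (rule braid_eq_step[of _ 2 1 _ 0]) (simp_all add: braid_move.bigon)
  also have "braid_eq 4 \<dots> [(1, Cross a), (1, Cross (flip a))]"
    by (rule braid_eq_step[of _ 2 1 _ 0]) (simp_all add: braid_move.bigon)
  also have "braid_eq 4 \<dots> []"
    by (rule braid_eq_step[of _ 2 0 _ 0]) (simp_all add: braid_move.bigon)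
  finally show ?thesis .
qed

text \<open>The same pair stays over: if it rises through the first crossing it falls through the
  second, and conversely. Hence \<open>flip c\<close> with the same \<open>d\<close>.\<close>

lemma over_crossing_inverse:
  "braid_eq 4 (over_crossing c d @ over_crossing (flip c) d) []"
  using pair_word_inverse[of RisingOver Virtual RisingOver Virtual]
    pair_word_inverse[of Virtual RisingOver Virtual RisingOver]
    pair_word_inverse[of Virtual Virtual FallingOver FallingOver]
    pair_word_inverse[of FallingOver FallingOver Virtual Virtual]
    pair_word_inverse[of Virtual Virtual Virtual Virtual]
  by (cases c; cases d) simp_all

lemma over_crossing_under_letter:
  assumes "c \<noteq> FallingOver"
  shows "braid_eq 4 ([(2, Cross x)] @ over_crossing c d) (over_crossing c d @ [(0, Cross x)])"
  using assms braid_eq_over_crossings[of RisingOver Virtual x]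
    braid_eq_over_crossings[of Virtual RisingOver x] braid_eq_over_crossings[of Virtual Virtual x]
  by (cases c; cases d) simp_all

lemma over_crossing_under_twist:
  assumes "c \<noteq> FallingOver"
  shows "braid_eq 4 (twist p e 2 @ over_crossing c d) (over_crossing c d @ twist p e 0)"
proof -
  have "braid_eq 4 ([(2, Cross x), (2, Cross y)] @ over_crossing c d)
      (over_crossing c d @ [(0, Cross x), (0, Cross y)])" for x y
  proof -
    have "braid_eq 4 ([(2, Cross x)] @ ([(2, Cross y)] @ over_crossing c d))
      ([(2, Cross x)] @ (over_crossing c d @ [(0, Cross y)]))"
      by (intro braid_eq_append braid_eq.refl over_crossing_under_letter assms)
    moreover have "braid_eq 4 (([(2, Cross x)] @ over_crossing c d) @ [(0, Cross y)])
      ((over_crossing c d @ [(0, Cross x)]) @ [(0, Cross y)])"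
      by (intro braid_eq_append braid_eq.refl over_crossing_under_letter assms)
    ultimately show ?thesis by (auto intro: braid_eq.trans)
  qed
  then show ?thesis by (cases p; cases e) simp_all
qed

text \<open>
  R passes over L and over the under strand, while these cross virtually: this is a welded move.
\<close>

lemma twist_over_strand:
  "braid_eq 3 (twist True Up 0 @ [(1, Cross RisingOver), (0, Cross Virtual)])
     ([(1, Cross RisingOver), (0, Cross Virtual)] @ twist True Up 1)"
  "braid_eq 3 (twist True Down 0 @ [(1, Cross Virtual), (0, Cross RisingOver)])
     ([(1, Cross Virtual), (0, Cross RisingOver)] @ twist True Down 1)"
proof -
  note tri = braid_move.triangle triangle_move_virtual_strand triangle_move_under_over
  \<comment> \<open>The first triangle move is mixed, as L meets R and the under strand virtually;
    the second is the welded move. For a pair oriented downwards they occur in the opposite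
    order.\<close>
  have "braid_eq 3
      [(0, Cross FallingOver), (0, Cross Virtual), (1, Cross RisingOver), (0, Cross Virtual)]
      [(0, Cross FallingOver), (1, Cross Virtual), (0, Cross RisingOver), (1, Cross Virtual)]"
    by (rule braid_eq_step[of _ 3 1 _ 3]) (simp_all add: tri)
  also have "braid_eq 3 \<dots>
      [(1, Cross RisingOver), (0, Cross Virtual), (1, Cross FallingOver), (1, Cross Virtual)]"
    by (rule braid_eq_step[of _ 3 0 _ 3]) (simp_all add: tri)
  finally show "braid_eq 3 (twist True Up 0 @ [(1, Cross RisingOver), (0, Cross Virtual)])
     ([(1, Cross RisingOver), (0, Cross Virtual)] @ twist True Up 1)" by simp
  have "braid_eq 3
      [(0, Cross Virtual), (0, Cross FallingOver), (1, Cross Virtual), (0, Cross RisingOver)]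
      [(0, Cross Virtual), (1, Cross RisingOver), (0, Cross Virtual), (1, Cross FallingOver)]"
    by (rule braid_eq_step[of _ 3 1 _ 3]) (simp_all add: tri)
  also have "braid_eq 3 \<dots>
      [(1, Cross Virtual), (0, Cross RisingOver), (1, Cross Virtual), (1, Cross FallingOver)]"
    by (rule braid_eq_step[of _ 3 0 _ 3]) (simp_all add: tri)
  finally show "braid_eq 3 (twist True Down 0 @ [(1, Cross Virtual), (0, Cross RisingOver)])
     ([(1, Cross Virtual), (0, Cross RisingOver)] @ twist True Down 1)" by simp
qed

lemma over_crossing_over_twist:
  "braid_eq 4 (twist p d 0 @ over_crossing RisingOver d) (over_crossing RisingOver d @ twist p d 2)"
proof -
  \<comment> \<open>\<open>A\<close> is the crossing of a single under strand with the over pair, so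
    that the twist passes the under pair one strand at a time.\<close>
  define A :: layers where "A = (if d = Up then [(1, Cross RisingOver), (0, Cross Virtual)]
    else [(1, Cross Virtual), (0, Cross RisingOver)])"
  have A: "over_crossing RisingOver d = A @ shift 1 A"
    by (cases d) (simp_all add: A_def)
  have t: "braid_eq 3 (twist True d 0 @ A) (A @ twist True d 1)"
    using twist_over_strand by (cases d) (simp_all add: A_def)
  have "braid_eq 4 (twist True d 0 @ A @ shift 1 A) (A @ twist True d 1 @ shift 1 A)"
    by (rule braid_eq_in[OF braid_eq_mono[OF t], where u = "[]" and v = "shift 1 A"]) simp_all
  also have "braid_eq 4 \<dots> (A @ shift 1 A @ twist True d 2)"
    by (rule braid_eq_in[OF braid_eq_shift[OF t, of 1], where u = A and v = "[]"])
      (simp_all add: twist_shift numeral_2_eq_2)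
  finally have *: "braid_eq 4 (twist True d 0 @ over_crossing RisingOver d)
      (over_crossing RisingOver d @ twist True d 2)"
    by (simp add: A)
  show ?thesis
  proof (cases p)
    case False
    then show ?thesis
      using braid_eq_conjugate[OF _ _ *, of "twist False d 0" "twist False d 2"]
        twist_inverse[of 0 4 False d] twist_inverse[of 2 4 True d] by simp
  qed (use * in simp)
qed

section \<open>Parallel crossings\<close>

abbreviation par_cross :: "crossing \<Rightarrow> orientation \<Rightarrow> orientation \<Rightarrow> layers" where
  "par_cross \<equiv> parallel_crossing 0"

lemma par_cross_shift: "parallel_crossing i c d e = shift (2 * i) (par_cross c d e)"
  by (cases c; cases d; cases e) (simp_all add: add_twist_def pairs_crossing_def)

lemma par_cross_below: "list_all (crossing_below 4) (par_cross c d e)"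
  by (cases c; cases d; cases e) (simp_all add: add_twist_def pairs_crossing_def)

lemma par_cross_Virtual: "par_cross Virtual d e = over_crossing Virtual d'"
  by (simp add: pairs_crossing_def numeral_2_eq_2)

text \<open>With the rising strand over, the crossing is positive exactly if \<open>d = e\<close>.
  The under pair is at position 2 below and at 0 above, the two places where
  \<open>add_twist\<close> may put the twist.\<close>

lemma par_cross_RisingOver_cases:
  "par_cross RisingOver d e = over_crossing RisingOver d @ twist (d = e) e 0 \<or>
   par_cross RisingOver d e = twist (d = e) e 2 @ over_crossing RisingOver d"
  by (cases d; cases e) (simp_all add: add_twist_def positive_def pairs_crossing_def is_R_copy_def)

lemma par_cross_FallingOver_cases:
  "par_cross FallingOver d e = over_crossing FallingOver e @ twist (d \<noteq> e) d 2 \<or>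
   par_cross FallingOver d e = twist (d \<noteq> e) d 0 @ over_crossing FallingOver e"
  by (cases d; cases e) (simp_all add: add_twist_def positive_def pairs_crossing_def is_R_copy_def)

text \<open>A crossing with the falling pair over is the inverse of one with the rising pair
  over.\<close>

lemma over_crossing_FallingOver_twist:
  "braid_eq 4 (twist p e 0 @ over_crossing FallingOver d) (over_crossing FallingOver d @ twist p e 2)"
  using braid_eq_conjugate'[OF _ _ over_crossing_under_twist[of RisingOver p e d]]
    over_crossing_inverse[of RisingOver d] over_crossing_inverse[of FallingOver d]
  by (auto intro: braid_eq.sym)

lemma par_cross_RisingOver:
  "braid_eq 4 (par_cross RisingOver d e) (over_crossing RisingOver d @ twist (d = e) e 0)"
  "braid_eq 4 (par_cross RisingOver d e) (twist (d = e) e 2 @ over_crossing RisingOver d)"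
  using par_cross_RisingOver_cases[of d e] over_crossing_under_twist[of RisingOver "d = e" e d]
  by (auto intro: braid_eq.refl braid_eq.sym)

lemma par_cross_FallingOver:
  "braid_eq 4 (par_cross FallingOver d e) (over_crossing FallingOver e @ twist (d \<noteq> e) d 2)"
  "braid_eq 4 (par_cross FallingOver d e) (twist (d \<noteq> e) d 0 @ over_crossing FallingOver e)"
  using par_cross_FallingOver_cases[of d e] over_crossing_FallingOver_twist[of "d \<noteq> e" d e]
  by (auto intro: braid_eq.refl braid_eq.sym)

text \<open>Two classical crossings here have the same under pair and opposite signs. With both
  twists placed between them, the twists meet and cancel, and then the over crossings do.\<close>

lemma par_cross_inverse:
  "braid_eq 4 (par_cross c d e @ par_cross (flip c) e d) []"
proof -
  have cancel: "braid_eq 4 ((u @ t) @ (t' @ v)) []"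
    if "braid_eq 4 (t @ t') []" "braid_eq 4 (u @ v) []" for t t' u v
    using that braid_eq_in[OF that(1), of "(u @ t) @ (t' @ v)" u v "u @ v"]
    by (auto intro: braid_eq.trans)
  show ?thesis
  proof (cases c)
    case RisingOver
    have "braid_eq 4 (par_cross RisingOver d e @ par_cross FallingOver e d)
      ((over_crossing RisingOver d @ twist (d = e) e 0) @
       (twist (e \<noteq> d) e 0 @ over_crossing FallingOver d))"
      by (intro braid_eq_append par_cross_RisingOver par_cross_FallingOver)
    also have "braid_eq 4 \<dots> []"
      using twist_inverse[of 0 4 "d = e" e] over_crossing_inverse[of RisingOver d]
      by (intro cancel) (auto simp: eq_commute)
    finally show ?thesis by (simp add: RisingOver)
  next
    case FallingOver
    have "braid_eq 4 (par_cross FallingOver d e @ par_cross RisingOver e d)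
      ((over_crossing FallingOver e @ twist (d \<noteq> e) d 2) @
       (twist (e = d) d 2 @ over_crossing RisingOver e))"
      by (intro braid_eq_append par_cross_RisingOver par_cross_FallingOver)
    also have "braid_eq 4 \<dots> []"
      using twist_inverse[of 2 4 "d \<noteq> e" d] over_crossing_inverse[of FallingOver e]
      by (intro cancel) (auto simp: eq_commute)
    finally show ?thesis by (simp add: FallingOver)
  next
    case Virtual
    then show ?thesis
      using over_crossing_inverse[of Virtual d]
      by (simp only: par_cross_Virtual[of _ _ d] flip.simps)
  qed
qed

lemma twist_through_RisingOver:
  "braid_eq 4 (twist p d 0 @ par_cross RisingOver d e) (par_cross RisingOver d e @ twist p d 2)"
  "braid_eq 4 (twist p e 2 @ par_cross RisingOver d e) (par_cross RisingOver d e @ twist p e 0)"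
proof -
  let ?P = "over_crossing RisingOver d" and ?t = "twist (d = e) e 0"
  \<comment> \<open>\<open>b'\<close> is the travelling twist after the over crossing, in front of
    the crossing's own twist \<open>?t\<close>. It passes \<open>?t\<close> because it lies on the
    other pair or is a twist of the same strand.\<close>
  have X: "braid_eq 4 (a @ par_cross RisingOver d e) (par_cross RisingOver d e @ b)"
    if "braid_eq 4 (a @ ?P) (?P @ b')" "braid_eq 4 (b' @ ?t) (?t @ b)" for a b b'
  proof -
    have "braid_eq 4 (a @ par_cross RisingOver d e) (a @ ?P @ ?t)"
      by (intro braid_eq_append braid_eq.refl par_cross_RisingOver)
    also have "braid_eq 4 \<dots> (?P @ b' @ ?t)"
      by (rule braid_eq_in[OF that(1), where u = "[]" and v = ?t]) simp_all
    also have "braid_eq 4 \<dots> ((?P @ ?t) @ b)"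
      by (rule braid_eq_in[OF that(2), where u = ?P and v = "[]"]) simp_all
    also have "braid_eq 4 \<dots> (par_cross RisingOver d e @ b)"
      by (intro braid_eq_append braid_eq.refl braid_eq.sym[OF par_cross_RisingOver(1)])
    finally show ?thesis .
  qed
  show "braid_eq 4 (twist p d 0 @ par_cross RisingOver d e) (par_cross RisingOver d e @ twist p d 2)"
    by (rule X[OF over_crossing_over_twist]) (simp add: braid_eq.sym[OF twist_far])
  show "braid_eq 4 (twist p e 2 @ par_cross RisingOver d e) (par_cross RisingOver d e @ twist p e 0)"
    by (rule X[OF over_crossing_under_twist twist_commute]) simp_all
qed

text \<open>The cases with the falling pair over follow from \<open>twist_through_RisingOver\<close>
  by inverting the crossing. A virtual crossing is inverted by a virtual one, which exchanges the
  two statements.\<close>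

lemma twist_through:
  "braid_eq 4 (twist p d 0 @ par_cross c d e) (par_cross c d e @ twist p d 2)"
  "braid_eq 4 (twist p e 2 @ par_cross c d e) (par_cross c d e @ twist p e 0)"
proof -
  have virtual: "braid_eq 4 (twist p e 2 @ par_cross Virtual d e) (par_cross Virtual d e @ twist p e 0)"
    for d e
    using over_crossing_under_twist[of Virtual p e d] by (simp only: par_cross_Virtual[of d e d] crossing.distinct simp_thms)
  note inverses = par_cross_inverse[of c d e] par_cross_inverse[of "flip c" e d]
  show "braid_eq 4 (twist p d 0 @ par_cross c d e) (par_cross c d e @ twist p d 2)"
    using twist_through_RisingOver virtual inverses
      braid_eq_conjugate'[of 4 "par_cross (flip c) e d" "par_cross c d e" "twist p d 2" "twist p d 0"]
    by (cases c) (auto intro: braid_eq.sym simp del: parallel_crossing.simps)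
  show "braid_eq 4 (twist p e 2 @ par_cross c d e) (par_cross c d e @ twist p e 0)"
    using twist_through_RisingOver virtual inverses
      braid_eq_conjugate'[of 4 "par_cross (flip c) e d" "par_cross c d e" "twist p e 0" "twist p e 2"]
    by (cases c) (auto intro: braid_eq.sym simp del: parallel_crossing.simps)
qed

text \<open>A letter of \<open>w\<close> at position 0 or 2 lies within one of the two under pairs:
  it passes one of the two crossings of pairs and is far from the other. A letter at position 1 lies
  between the under pairs and meets both crossings.\<close>

lemma over_crossings_pass:
  assumes "c \<noteq> FallingOver" "list_all (crossing_below 4) w"
  shows "braid_eq 6 (shift 2 w @ over_crossing c d @ shift 2 (over_crossing c d))
           (over_crossing c d @ shift 2 (over_crossing c d) @ w)"
proof -
  let ?P = "over_crossing c d"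
  let ?Q = "?P @ shift 2 ?P"
  have P: "list_all (crossing_below 6) ?P" "list_all (\<lambda>(i, _). i < 3) ?P"
    by (cases c; cases d; simp)+
  have sP: "list_all (crossing_below 6) (shift 2 ?P)" "list_all (\<lambda>(i, _). 1 < i) (shift 2 ?P)"
    by (cases c; cases d; simp)+
  \<comment> \<open>The letter \<open>x\<close> crosses one strand of each under pair, so its two
    triangle moves use letters of both over crossings, which far commutation first brings
    together.\<close>
  have mid: "braid_eq 6 ((3, Cross x) # ?Q) (?Q @ [(1, Cross x)])" for x
  proof -
    have *: "braid_eq 6
      ((3, Cross x) # pair_word a b a b @ [(3, Cross a), (2, Cross b), (4, Cross a), (3, Cross b)])
      (pair_word a b a b @ [(3, Cross a), (2, Cross b), (4, Cross a), (3, Cross b), (1, Cross x)])"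
      if "a \<noteq> FallingOver" "b \<noteq> FallingOver" for a b
    proof -
      note tri = braid_move.triangle triangle_move_over[OF that(1)] triangle_move_over[OF that(2)]
      have "braid_eq 6
        ((3, Cross x) # pair_word a b a b @ [(3, Cross a), (2, Cross b), (4, Cross a), (3, Cross b)])
        [(1, Cross a), (3, Cross x), (0, Cross b), (2, Cross a), (1, Cross b), (3, Cross a),
          (2, Cross b), (4, Cross a), (3, Cross b)]"
        by (rule braid_eq_step[of _ 2 0 _ 2]) (simp_all add: braid_move.far)
      also have "braid_eq 6 \<dots>
        [(1, Cross a), (0, Cross b), (3, Cross x), (2, Cross a), (1, Cross b), (3, Cross a),
          (2, Cross b), (4, Cross a), (3, Cross b)]"
        by (rule braid_eq_step[of _ 2 1 _ 2]) (simp_all add: braid_move.far)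
      also have "braid_eq 6 \<dots>
        [(1, Cross a), (0, Cross b), (3, Cross x), (2, Cross a), (3, Cross a), (1, Cross b),
          (2, Cross b), (4, Cross a), (3, Cross b)]"
        by (rule braid_eq_step[of _ 2 4 _ 2]) (simp_all add: braid_move.far)
      also have "braid_eq 6 \<dots>
        [(1, Cross a), (0, Cross b), (2, Cross a), (3, Cross a), (2, Cross x), (1, Cross b),
          (2, Cross b), (4, Cross a), (3, Cross b)]"
        by (rule braid_eq_step[of _ 3 2 _ 3]) (simp_all add: tri)
      also have "braid_eq 6 \<dots>
        [(1, Cross a), (0, Cross b), (2, Cross a), (3, Cross a), (1, Cross b), (2, Cross b),
          (1, Cross x), (4, Cross a), (3, Cross b)]"
        by (rule braid_eq_step[of _ 3 4 _ 3]) (simp_all add: tri)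
      also have "braid_eq 6 \<dots>
        [(1, Cross a), (0, Cross b), (2, Cross a), (1, Cross b), (3, Cross a), (2, Cross b),
          (1, Cross x), (4, Cross a), (3, Cross b)]"
        by (rule braid_eq_step[of _ 2 3 _ 2]) (simp_all add: braid_move.far)
      also have "braid_eq 6 \<dots>
        [(1, Cross a), (0, Cross b), (2, Cross a), (1, Cross b), (3, Cross a), (2, Cross b),
          (4, Cross a), (1, Cross x), (3, Cross b)]"
        by (rule braid_eq_step[of _ 2 6 _ 2]) (simp_all add: braid_move.far)
      also have "braid_eq 6 \<dots>
        (pair_word a b a b @ [(3, Cross a), (2, Cross b), (4, Cross a), (3, Cross b), (1, Cross x)])"
        by (rule braid_eq_step[of _ 2 7 _ 2]) (simp_all add: braid_move.far)
      finally show ?thesis .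
    qed
    show ?thesis
      using assms(1) *[of RisingOver Virtual] *[of Virtual RisingOver] *[of Virtual Virtual]
      by (cases c; cases d) simp_all
  qed
  have letter: "braid_eq 6 ((2 + i, Cross x) # ?Q) (?Q @ [(i, Cross x)])" if "i < 3" for i x
  proof -
    consider "i = 0" | "i = 1" | "i = 2" using \<open>i < 3\<close> by linarith
    then show ?thesis
    proof cases
      case 1
      have far: "braid_eq 6 ([(0, Cross x)] @ shift 2 ?P) (shift 2 ?P @ [(0, Cross x)])"
        by (rule braid_eq_far[where k = 1]) (use sP in simp_all)
      have "braid_eq 6 ([(2, Cross x)] @ ?Q) (?P @ [(0, Cross x)] @ shift 2 ?P)"
        by (rule braid_eq_in[OF braid_eq_mono[OF over_crossing_under_letter[OF assms(1), of x d]],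
              where u = "[]" and v = "shift 2 ?P"]) simp_all
      also have "braid_eq 6 \<dots> (?P @ shift 2 ?P @ [(0, Cross x)])"
        by (rule braid_eq_in[OF far, where u = ?P and v = "[]"]) simp_all
      finally show ?thesis using 1 by simp
    next
      case 2
      then show ?thesis using mid[of x] by (simp add: eval_nat_numeral)
    next
      case 3
      have far: "braid_eq 6 (?P @ [(4, Cross x)]) ([(4, Cross x)] @ ?P)"
        by (rule braid_eq_far[where k = 3]) (use P in simp_all)
      have "braid_eq 6 ([(4, Cross x)] @ ?Q) (?P @ [(4, Cross x)] @ shift 2 ?P)"
        by (rule braid_eq_in[OF braid_eq.sym[OF far], where u = "[]" and v = "shift 2 ?P"]) simp_all
      also have "braid_eq 6 \<dots> (?P @ shift 2 ?P @ [(2, Cross x)])"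
        by (rule braid_eq_in[OF braid_eq_shift[OF over_crossing_under_letter[OF assms(1), of x d],
                of 2], where u = ?P and v = "[]"]) simp_all
      finally show ?thesis using 3 by simp
    qed
  qed
  from assms(2) have "braid_eq 6 (shift 2 w @ ?Q) (?Q @ w)"
  proof (induction w)
    case Nil
    then show ?case by (simp add: braid_eq.refl)
  next
    case (Cons l w)
    then obtain i x where l: "l = (i, Cross x)" "i < 3"
      by (cases "(4 :: nat, l)" rule: crossing_below.cases) auto
    have "braid_eq 6 (shift 2 (l # w) @ ?Q) ([(2 + i, Cross x)] @ ?Q @ w)"
      by (rule braid_eq_in[OF Cons.IH, where u = "[(2 + i, Cross x)]" and v = "[]"])
        (use Cons.prems in \<open>simp_all add: l\<close>)
    also have "braid_eq 6 \<dots> (?Q @ l # w)"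
      by (rule braid_eq_in[OF letter[OF l(2)], where u = "[]" and v = w]) (simp_all add: l)
    finally show ?case .
  qed
  then show ?thesis by simp
qed

section \<open>Triangle moves of pairs\<close>

definition par_triangle where
  "par_triangle a b c d1 d2 d3 \<longleftrightarrow> braid_eq 6
     (par_cross a d1 d2 @ shift 2 (par_cross b d1 d3) @ par_cross c d2 d3)
     (shift 2 (par_cross c d2 d3) @ par_cross b d1 d3 @ shift 2 (par_cross a d1 d2))"

text \<open>The twists of the two crossings of strand 1 are gathered between its over crossings and
  \<open>?Y\<close>. They pass through \<open>?Y\<close>, exchanging places as the pairs 2 and 3 do;
  then \<open>?Y\<close> slides across the over pair, and the twists return to their
  crossings.\<close>

lemma par_triangle_RisingOver: "par_triangle RisingOver RisingOver c d1 d2 d3"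
proof -
  let ?P = "over_crossing RisingOver d1" and ?Y = "par_cross c d2 d3"
  let ?t2 = "twist (d1 = d2) d2" and ?t3 = "twist (d1 = d3) d3"
  note shift_RisingOver = braid_eq_shift[OF par_cross_RisingOver(1)[of d1], of 2 6, simplified]
    and mono_RisingOver = braid_eq_mono[OF par_cross_RisingOver(1)[of d1], of 6, simplified]
  have "list_all (crossing_below 6) (shift 2 ?P)" "list_all (\<lambda>(i, _). 1 < i) (shift 2 ?P)"
    by (cases d1; simp)+
  then have far: "braid_eq 6 (twist p d 0 @ shift 2 ?P) (shift 2 ?P @ twist p d 0)" for p d
    by (cases p; cases d; intro braid_eq_far[where k = 1]; simp)
  have "braid_eq 6 (par_cross RisingOver d1 d2 @ shift 2 (par_cross RisingOver d1 d3) @ ?Y)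
      ((?P @ ?t2 0) @ (shift 2 (?P @ ?t3 0)) @ ?Y)"
    using shift_RisingOver mono_RisingOver by (intro braid_eq_append braid_eq.refl) simp_all
  also have "braid_eq 6 \<dots> (?P @ shift 2 ?P @ ?t2 0 @ ?t3 2 @ ?Y)"
    by (rule braid_eq_in[OF far[of "d1 = d2" d2], where u = ?P and v = "?t3 2 @ ?Y"])
      (simp_all add: twist_shift)
  also have "braid_eq 6 \<dots> (?P @ shift 2 ?P @ ?t2 0 @ ?Y @ ?t3 0)"
    by (intro braid_eq_append braid_eq.refl braid_eq_mono[OF twist_through(2)]) simp_all
  also have "braid_eq 6 \<dots> (?P @ shift 2 ?P @ ?Y @ ?t2 2 @ ?t3 0)"
    by (rule braid_eq_in[OF braid_eq_mono[OF twist_through(1)[of "d1 = d2" d2 c d3]],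
          where u = "?P @ shift 2 ?P" and v = "?t3 0"]) simp_all
  also have "braid_eq 6 \<dots> (shift 2 ?Y @ ?P @ shift 2 ?P @ ?t2 2 @ ?t3 0)"
    by (rule braid_eq_in[OF braid_eq.sym[OF over_crossings_pass[OF _ par_cross_below]],
          where u = "[]" and v = "?t2 2 @ ?t3 0"]) simp_all
  also have "braid_eq 6 \<dots> (shift 2 ?Y @ ?P @ shift 2 ?P @ ?t3 0 @ ?t2 2)"
    by (intro braid_eq_append braid_eq.refl braid_eq.sym[OF twist_far]) simp_all
  also have "braid_eq 6 \<dots> (shift 2 ?Y @ (?P @ ?t3 0) @ shift 2 (?P @ ?t2 0))"
    by (rule braid_eq_in[OF braid_eq.sym[OF far], where u = "shift 2 ?Y @ ?P" and v = "?t2 2"])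
      (simp_all add: twist_shift)
  also have "braid_eq 6 \<dots>
      (shift 2 ?Y @ par_cross RisingOver d1 d3 @ shift 2 (par_cross RisingOver d1 d2))"
    using shift_RisingOver[THEN braid_eq.sym] mono_RisingOver[THEN braid_eq.sym]
    by (intro braid_eq_append braid_eq.refl) simp_all
  finally show ?thesis by (simp add: par_triangle_def)
qed

lemma par_triangle_Virtual: "par_triangle Virtual Virtual c d1 d2 d3"
proof -
  show ?thesis
    unfolding par_triangle_def par_cross_Virtual[of _ _ d1]
    by (rule braid_eq.sym, rule over_crossings_pass[OF _ par_cross_below]) simp
qed

text \<open>Composing both sides with the inverse of the crossing of strands 2 and 3, once below and
  once above, turns the triangle move into the one with these strands exchanged.\<close>

lemma par_triangle_mirror_right:
  assumes "par_triangle a b c d1 d2 d3"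
  shows "par_triangle b a (flip c) d1 d3 d2"
proof -
  let ?A = "par_cross a d1 d2" and ?B = "par_cross b d1 d3" and ?C = "par_cross c d2 d3"
  let ?D = "par_cross (flip c) d3 d2"
  have CD: "braid_eq 6 (?C @ ?D) []"
    using braid_eq_mono[OF par_cross_inverse] by simp
  have DC: "braid_eq 6 (shift 2 ?D @ shift 2 ?C) []"
    using braid_eq_shift[OF par_cross_inverse[of "flip c" d3 d2], of 2 6] by simp
  have "braid_eq 6 (shift 2 ?D @ ?A @ shift 2 ?B) (shift 2 ?D @ ?A @ shift 2 ?B @ ?C @ ?D)"
    by (rule braid_eq_in[OF braid_eq.sym[OF CD], where u = "shift 2 ?D @ ?A @ shift 2 ?B" and v = "[]"])
      simp_all
  also have "braid_eq 6 \<dots> (shift 2 ?D @ shift 2 ?C @ ?B @ shift 2 ?A @ ?D)"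
    by (rule braid_eq_in[OF assms[unfolded par_triangle_def], where u = "shift 2 ?D" and v = ?D])
      simp_all
  also have "braid_eq 6 \<dots> (?B @ shift 2 ?A @ ?D)"
    by (rule braid_eq_in[OF DC, where u = "[]" and v = "?B @ shift 2 ?A @ ?D"]) simp_all
  finally show ?thesis by (auto simp: par_triangle_def intro: braid_eq.sym)
qed

text \<open>Here the crossing that is cancelled on both sides is that of strands 1 and 2.\<close>

lemma par_triangle_mirror_left:
  assumes "par_triangle a b c d1 d2 d3"
  shows "par_triangle (flip a) c b d2 d1 d3"
proof -
  let ?A = "par_cross a d1 d2" and ?B = "par_cross b d1 d3" and ?C = "par_cross c d2 d3"
  let ?D = "par_cross (flip a) d2 d1"
  have AD: "braid_eq 6 (shift 2 ?A @ shift 2 ?D) []"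
    using braid_eq_shift[OF par_cross_inverse[of a d1 d2], of 2 6] by simp
  have DA: "braid_eq 6 (?D @ ?A) []"
    using braid_eq_mono[OF par_cross_inverse[of "flip a" d2 d1], of 6] by simp
  have "braid_eq 6 (?D @ shift 2 ?C @ ?B) (?D @ shift 2 ?C @ ?B @ shift 2 ?A @ shift 2 ?D)"
    by (rule braid_eq_in[OF braid_eq.sym[OF AD], where u = "?D @ shift 2 ?C @ ?B" and v = "[]"])
      simp_all
  also have "braid_eq 6 \<dots> (?D @ ?A @ shift 2 ?B @ ?C @ shift 2 ?D)"
    by (rule braid_eq_in[OF braid_eq.sym[OF assms[unfolded par_triangle_def]],
          where u = ?D and v = "shift 2 ?D"]) simp_all
  also have "braid_eq 6 \<dots> (shift 2 ?B @ ?C @ shift 2 ?D)"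
    by (rule braid_eq_in[OF DA, where u = "[]" and v = "shift 2 ?B @ ?C @ shift 2 ?D"]) simp_all
  finally show ?thesis by (simp add: par_triangle_def)
qed

text \<open>
  The strand that passes over the other two, or virtually across them, is 1, 2, 3, respectively.
\<close>

lemma par_triangle_moved:
  assumes "k \<noteq> FallingOver"
  shows "par_triangle k k c d1 d2 d3" "par_triangle (flip k) c k d1 d2 d3"
    "par_triangle c (flip k) (flip k) d1 d2 d3"
proof -
  show 1: "par_triangle k k c d1 d2 d3" for c d1 d2 d3
    using assms par_triangle_RisingOver par_triangle_Virtual by (cases k) auto
  show 2: "par_triangle (flip k) c k d1 d2 d3" for c d1 d2 d3
    using par_triangle_mirror_left[OF 1] .
  show "par_triangle c (flip k) (flip k) d1 d2 d3"
    using par_triangle_mirror_right[OF 2] .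
qed

section \<open>Parallel minima and maxima\<close>

text \<open>From bottom to top, nested maxima begin with the inner one and nested minima with the
  outer one, so the arms above \<open>cups i a b\<close> read \<open>a\<close>, \<open>b\<close>,
  \<open>opp b\<close>, \<open>opp a\<close>.\<close>

abbreviation "caps i \<equiv> [(i + 1, Cap), (i, Cap)]"
abbreviation "cups i a b \<equiv> [(i, Cup a), (i + 1, Cup b)]"

text \<open>Positions are separate variables in order to match numerals, and the two kink rules
  unite the classical and the virtual move I.\<close>

lemma local_move_simps:
  "j = i + 1 \<Longrightarrow> local_move [(j, Cup d), (i, Cap)] []"
  "j = i + 1 \<Longrightarrow> local_move [(i, Cup d), (j, Cap)] []"
  "\<lbrakk>j = i + 1; i' = i; j' = j; c' = flip c\<rbrakk> \<Longrightarrow>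
     local_move [(j, Cross c), (i, Cap)] [(i', Cross c'), (j', Cap)]"
  "\<lbrakk>j = i + 1; i' = i; j' = j; c' = flip c\<rbrakk> \<Longrightarrow>
     local_move [(i, Cup d), (j, Cross c)] [(j', Cup d), (i', Cross c')]"
  "\<lbrakk>j = i + 1; j' = j\<rbrakk> \<Longrightarrow> local_move [(j, Cup d), (i, Cross c), (j', Cap)] []"
  "\<lbrakk>j = i + 1; i' = i\<rbrakk> \<Longrightarrow> local_move [(i, Cup d), (j, Cross c), (i', Cap)] []"
  "\<lbrakk>triangle_move a b c; j = i + 1; i' = i; i'' = i; j' = j; j'' = j\<rbrakk> \<Longrightarrow>
     local_move [(i, Cross a), (j, Cross b), (i', Cross c)] [(j', Cross c), (i'', Cross b), (j'', Cross a)]"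
proof -
  show "\<lbrakk>j = i + 1; j' = j\<rbrakk> \<Longrightarrow> local_move [(j, Cup d), (i, Cross c), (j', Cap)] []"
    using classical_move.R1_right[of c i d] virtual_move.V1_right[of i d]
    by (cases "c = Virtual") (auto simp: local_move_def kink_right_def)
  show "\<lbrakk>j = i + 1; i' = i\<rbrakk> \<Longrightarrow> local_move [(i, Cup d), (j, Cross c), (i', Cap)] []"
    using classical_move.R1_left[of c i d] virtual_move.V1_left[of i d]
    by (cases "c = Virtual") (auto simp: local_move_def kink_left_def)
  show "\<lbrakk>triangle_move a b c; j = i + 1; i' = i; i'' = i; j' = j; j'' = j\<rbrakk> \<Longrightarrow>
     local_move [(i, Cross a), (j, Cross b), (i', Cross c)] [(j', Cross c), (i'', Cross b), (j'', Cross a)]"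
    by (simp add: triangle_move_def triangle_def triangle'_def)
qed (use isotopy_move.intros in \<open>simp_all add: local_move_def\<close>)

lemma tangle_eq_in:
  assumes "tangle_eq t m m'" "layers_top u s = Some (a @ t @ b)"
    "w = u @ shift (length a) m @ v" "w' = u @ shift (length a) m' @ v"
  shows "tangle_eq s w w'"
  unfolding assms(3,4)
  by (rule tangle_eq.above[OF assms(2) tangle_eq.below[OF tangle_eq_frame[OF assms(1)]]])

section \<open>Twists and crossings of pairs near minima and maxima\<close>

lemma twist_top [simp]: "layers_top (twist p d 0) [a, b] = Some [a, b]"
  by (cases p; cases d) simp_all

lemma over_crossing_top [simp]:
  "layers_top (over_crossing k d) (a # b # c # e # s) = Some (c # e # a # b # s)"
  "layers_top (shift 2 (over_crossing k d)) (a # b # c # e # g # h # s) = Some (a # b # g # h # c # e # s)"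
  by (cases k; cases d; simp)+

text \<open>Turning the strand around reverses the order in which the two crossings are met from
  bottom to top.\<close>

lemma twist_opp:
  "\<exists>x y. \<forall>j. twist p d j = [(j, Cross x), (j, Cross y)] \<and>
     twist p (opp d) j = [(j, Cross y), (j, Cross x)]"
  by (cases p; cases d) auto

text \<open>The crossing passes two maxima; each passage flips its kind, so it is \<open>c\<close>
  again at the end.\<close>

lemma crossing_over_caps:
  "tangle_eq [a, b, opp a, opp b] ((0, Cross c) # caps 0) ((2, Cross c) # caps 0)"
proof -
  have "tangle_eq [a, b, opp a, opp b] ((0, Cross c) # caps 0)
      [(1, Cross (flip c)), (0, Cap), (0, Cap)]"
    by (rule tangle_eq_step[of 2 0 _ 2]) (simp_all add: local_move_simps)
  also have "tangle_eq [a, b, opp a, opp b] \<dots> [(1, Cross (flip c)), (2, Cap), (0, Cap)]"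
    by (rule tangle_eq_step[of 2 1 _ 2]) (simp_all add: local_exchange)
  also have "tangle_eq [a, b, opp a, opp b] \<dots> ((2, Cross c) # caps 0)"
    by (rule tangle_eq_step[of 2 0 _ 2]) (simp_all add: local_move_simps)
  finally show ?thesis .
qed

text \<open>The upper crossing passes first and ends up lowest. By \<open>twist_opp\<close> this
  reversal gives the twist of a strand running the other way, as it does beyond the maximum.\<close>

lemma twist_over_caps:
  "tangle_eq [a, b, opp b, opp a] (twist p d 0 @ caps 0) (twist p (opp d) 2 @ caps 0)"
proof -
  obtain x y where t: "\<And>j. twist p d j = [(j, Cross x), (j, Cross y)]"
    "\<And>j. twist p (opp d) j = [(j, Cross y), (j, Cross x)]"
    using twist_opp[of p d] by blast
  have "tangle_eq [a, b, opp b, opp a] (twist p d 0 @ caps 0)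
      ([(0, Cross x), (2, Cross y)] @ caps 0)"
    by (rule tangle_eq_in[OF crossing_over_caps[of b a y], where a = "[]" and b = "[]"
          and u = "[(0, Cross x)]" and v = "[]"]) (simp_all add: t)
  also have "tangle_eq [a, b, opp b, opp a] \<dots> ([(2, Cross y), (0, Cross x)] @ caps 0)"
    by (rule tangle_eq_step[of 2 0 _ 2]) (simp_all add: local_exchange)
  also have "tangle_eq [a, b, opp b, opp a] \<dots> (twist p (opp d) 2 @ caps 0)"
    by (rule tangle_eq_in[OF crossing_over_caps[of a b x], where a = "[]" and b = "[]"
          and u = "[(2, Cross y)]" and v = "[]"]) (simp_all add: t)
  finally show ?thesis .
qed

lemma crossing_over_cups:
  "tangle_eq [] (cups 0 a b @ [(0, Cross c)]) (cups 0 b a @ [(2, Cross c)])"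
proof -
  have "tangle_eq [] (cups 0 a b @ [(0, Cross c)])
      [(0, Cup a), (0, Cup b), (1, Cross (flip c))]"
    by (rule tangle_eq_step[of 2 1 _ 2]) (simp_all add: local_move_simps)
  also have "tangle_eq [] \<dots> [(0, Cup b), (2, Cup a), (1, Cross (flip c))]"
    by (rule tangle_eq_step[of 2 0 _ 2]) (simp_all add: local_exchange)
  also have "tangle_eq [] \<dots> (cups 0 b a @ [(2, Cross c)])"
    by (rule tangle_eq_step[of 2 1 _ 2]) (simp_all add: local_move_simps)
  finally show ?thesis .
qed

lemma twist_over_cups:
  "tangle_eq [] (cups 0 a b @ twist p d 0) (cups 0 a b @ twist p (opp d) 2)"
proof -
  obtain x y where t: "\<And>j. twist p d j = [(j, Cross x), (j, Cross y)]"
    "\<And>j. twist p (opp d) j = [(j, Cross y), (j, Cross x)]"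
    using twist_opp[of p d] by blast
  have "tangle_eq [] (cups 0 a b @ twist p d 0) (cups 0 b a @ [(2, Cross x), (0, Cross y)])"
    by (rule tangle_eq_in[OF crossing_over_cups[of a b x], where a = "[]" and b = "[]"
          and u = "[]" and v = "[(0, Cross y)]"]) (simp_all add: t)
  also have "tangle_eq [] \<dots> (cups 0 b a @ [(0, Cross y), (2, Cross x)])"
    by (rule tangle_eq_step[of 2 2 _ 2]) (simp_all add: local_exchange)
  also have "tangle_eq [] \<dots> (cups 0 a b @ twist p (opp d) 2)"
    by (rule tangle_eq_in[OF crossing_over_cups[of b a y], where a = "[]" and b = "[]"
          and u = "[]" and v = "[(2, Cross x)]"]) (simp_all add: t)
  finally show ?thesis .
qed

text \<open>Each of the four crossings undergoes one \<open>cap_through\<close>; the remaining steps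
  only change heights. The permutation of the kinds is the quarter turn of the two-by-two grid of
  crossings.\<close>

lemma pair_word_cap_through:
  "tangle_eq [p, q, r, s, opp q, opp p] (shift 2 (pair_word a b c d) @ caps 0)
     (pair_word (flip b) (flip d) (flip a) (flip c) @ caps 2)"
  (is "tangle_eq ?s _ _")
proof -
  have "tangle_eq ?s (shift 2 (pair_word a b c d) @ caps 0)
    [(3, Cross a), (2, Cross b), (4, Cross c), (1, Cap), (1, Cross d), (0, Cap)]"
    by (rule tangle_eq_step[of 2 3 _ 2]) (simp_all add: local_exchange)
  also have "tangle_eq ?s \<dots>
    [(3, Cross a), (2, Cross b), (1, Cap), (2, Cross c), (1, Cross d), (0, Cap)]"
    by (rule tangle_eq_step[of 2 2 _ 2]) (simp_all add: local_exchange)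
  also have "tangle_eq ?s \<dots>
    [(3, Cross a), (1, Cross (flip b)), (2, Cap), (2, Cross c), (1, Cross d), (0, Cap)]"
    by (rule tangle_eq_step[of 2 1 _ 2]) (simp_all add: local_move_simps)
  also have "tangle_eq ?s \<dots>
    [(1, Cross (flip b)), (3, Cross a), (2, Cap), (2, Cross c), (1, Cross d), (0, Cap)]"
    by (rule tangle_eq_step[of 2 0 _ 2]) (simp_all add: local_exchange)
  also have "tangle_eq ?s \<dots>
    [(1, Cross (flip b)), (2, Cross (flip a)), (3, Cap), (2, Cross c), (1, Cross d), (0, Cap)]"
    by (rule tangle_eq_step[of 2 1 _ 2]) (simp_all add: local_move_simps)
  also have "tangle_eq ?s \<dots>
    [(1, Cross (flip b)), (2, Cross (flip a)), (3, Cap), (2, Cross c), (0, Cross (flip d)), (1, Cap)]"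
    by (rule tangle_eq_step[of 2 4 _ 2]) (simp_all add: local_move_simps)
  also have "tangle_eq ?s \<dots>
    [(1, Cross (flip b)), (2, Cross (flip a)), (3, Cap), (0, Cross (flip d)), (2, Cross c), (1, Cap)]"
    by (rule tangle_eq_step[of 2 3 _ 2]) (simp_all add: local_exchange)
  also have "tangle_eq ?s \<dots>
    [(1, Cross (flip b)), (2, Cross (flip a)), (3, Cap), (0, Cross (flip d)), (1, Cross (flip c)), (2, Cap)]"
    by (rule tangle_eq_step[of 2 4 _ 2]) (simp_all add: local_move_simps)
  also have "tangle_eq ?s \<dots>
    [(1, Cross (flip b)), (2, Cross (flip a)), (0, Cross (flip d)), (3, Cap), (1, Cross (flip c)), (2, Cap)]"
    by (rule tangle_eq_step[of 2 2 _ 2]) (simp_all add: local_exchange)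
  also have "tangle_eq ?s \<dots>
    [(1, Cross (flip b)), (2, Cross (flip a)), (0, Cross (flip d)), (1, Cross (flip c)), (3, Cap), (2, Cap)]"
    by (rule tangle_eq_step[of 2 3 _ 2]) (simp_all add: local_exchange)
  also have "tangle_eq ?s \<dots> (pair_word (flip b) (flip d) (flip a) (flip c) @ caps 2)"
    by (rule tangle_eq_step[of 2 1 _ 2]) (simp_all add: local_exchange)
  finally show ?thesis .
qed

text \<open>The grid turns in the opposite direction, whence the inverse permutation.\<close>

lemma pair_word_cup_through:
  "tangle_eq [r, s] (cups 0 p q @ shift 2 (pair_word a b c d))
     (cups 2 p q @ pair_word (flip c) (flip a) (flip d) (flip b))"
  (is "tangle_eq ?s _ _")
proof -
  have "tangle_eq ?s (cups 0 p q @ shift 2 (pair_word a b c d))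
    [(0, Cup p), (1, Cross a), (1, Cup q), (2, Cross b), (4, Cross c), (3, Cross d)]"
    by (rule tangle_eq_step[of 2 1 _ 2]) (simp_all add: local_exchange)
  also have "tangle_eq ?s \<dots>
    [(1, Cup p), (0, Cross (flip a)), (1, Cup q), (2, Cross b), (4, Cross c), (3, Cross d)]"
    by (rule tangle_eq_step[of 2 0 _ 2]) (simp_all add: local_move_simps)
  also have "tangle_eq ?s \<dots>
    [(1, Cup p), (0, Cross (flip a)), (2, Cup q), (1, Cross (flip b)), (4, Cross c), (3, Cross d)]"
    by (rule tangle_eq_step[of 2 2 _ 2]) (simp_all add: local_move_simps)
  also have "tangle_eq ?s \<dots>
    [(1, Cup p), (0, Cross (flip a)), (2, Cup q), (4, Cross c), (1, Cross (flip b)), (3, Cross d)]"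
    by (rule tangle_eq_step[of 2 3 _ 2]) (simp_all add: local_exchange)
  also have "tangle_eq ?s \<dots>
    [(1, Cup p), (0, Cross (flip a)), (2, Cross c), (2, Cup q), (1, Cross (flip b)), (3, Cross d)]"
    by (rule tangle_eq_step[of 2 2 _ 2]) (simp_all add: local_exchange)
  also have "tangle_eq ?s \<dots>
    [(1, Cup p), (2, Cross c), (0, Cross (flip a)), (2, Cup q), (1, Cross (flip b)), (3, Cross d)]"
    by (rule tangle_eq_step[of 2 1 _ 2]) (simp_all add: local_exchange)
  also have "tangle_eq ?s \<dots>
    [(2, Cup p), (1, Cross (flip c)), (0, Cross (flip a)), (2, Cup q), (1, Cross (flip b)), (3, Cross d)]"
    by (rule tangle_eq_step[of 2 0 _ 2]) (simp_all add: local_move_simps)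
  also have "tangle_eq ?s \<dots>
    [(2, Cup p), (1, Cross (flip c)), (0, Cross (flip a)), (2, Cup q), (3, Cross d), (1, Cross (flip b))]"
    by (rule tangle_eq_step[of 2 4 _ 2]) (simp_all add: local_exchange)
  also have "tangle_eq ?s \<dots>
    [(2, Cup p), (1, Cross (flip c)), (0, Cross (flip a)), (3, Cup q), (2, Cross (flip d)), (1, Cross (flip b))]"
    by (rule tangle_eq_step[of 2 3 _ 2]) (simp_all add: local_move_simps)
  also have "tangle_eq ?s \<dots>
    [(2, Cup p), (1, Cross (flip c)), (3, Cup q), (0, Cross (flip a)), (2, Cross (flip d)), (1, Cross (flip b))]"
    by (rule tangle_eq_step[of 2 2 _ 2]) (simp_all add: local_exchange)
  also have "tangle_eq ?s \<dots> (cups 2 p q @ pair_word (flip c) (flip a) (flip d) (flip b))"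
    by (rule tangle_eq_step[of 2 1 _ 2]) (simp_all add: local_exchange)
  finally show ?thesis .
qed

text \<open>\<open>b\<close> and \<open>c\<close> are the self-crossings of the two copies, removed
  by move I; \<open>a\<close> and \<open>d\<close>, where the copies cross each other, remain. Once
  \<open>c\<close> is gone, the triangle move puts \<open>b\<close> next to its minimum and maximum
  and \<open>a\<close>, \<open>d\<close> far from them.\<close>

lemma pair_word_kink_right:
  assumes "triangle_move d b a"
  shows "tangle_eq [p, q] (cups 2 p q @ pair_word a b c d @ caps 2) [(0, Cross d), (0, Cross a)]"
  (is "tangle_eq ?s _ _")
proof -
  have "tangle_eq ?s (cups 2 p q @ pair_word a b c d @ caps 2)
    [(2, Cup p), (1, Cross a), (3, Cup q), (0, Cross b), (2, Cross c), (1, Cross d), (3, Cap), (2, Cap)]"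
    by (rule tangle_eq_step[of 2 1 _ 2]) (simp_all add: local_exchange)
  also have "tangle_eq ?s \<dots>
    [(2, Cup p), (1, Cross a), (0, Cross b), (3, Cup q), (2, Cross c), (1, Cross d), (3, Cap), (2, Cap)]"
    by (rule tangle_eq_step[of 2 2 _ 2]) (simp_all add: local_exchange)
  also have "tangle_eq ?s \<dots>
    [(2, Cup p), (1, Cross a), (0, Cross b), (3, Cup q), (2, Cross c), (3, Cap), (1, Cross d), (2, Cap)]"
    by (rule tangle_eq_step[of 2 5 _ 2]) (simp_all add: local_exchange)
  also have "tangle_eq ?s \<dots> [(2, Cup p), (1, Cross a), (0, Cross b), (1, Cross d), (2, Cap)]"
    by (rule tangle_eq_step[of 3 3 _ 0]) (simp_all add: local_move_simps)
  also have "tangle_eq ?s \<dots> [(2, Cup p), (0, Cross d), (1, Cross b), (0, Cross a), (2, Cap)]"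
    by (rule tangle_eq_step[of 3 1 _ 3]) (simp_all add: local_move_simps assms)
  also have "tangle_eq ?s \<dots> [(0, Cross d), (2, Cup p), (1, Cross b), (0, Cross a), (2, Cap)]"
    by (rule tangle_eq_step[of 2 0 _ 2]) (simp_all add: local_exchange)
  also have "tangle_eq ?s \<dots> [(0, Cross d), (2, Cup p), (1, Cross b), (2, Cap), (0, Cross a)]"
    by (rule tangle_eq_step[of 2 3 _ 2]) (simp_all add: local_exchange)
  also have "tangle_eq ?s \<dots> [(0, Cross d), (0, Cross a)]"
    by (rule tangle_eq_step[of 3 1 _ 0]) (simp_all add: local_move_simps)
  finally show ?thesis .
qed

text \<open>On this side \<open>b\<close> is removed first and \<open>c\<close> after the triangle
  move.\<close>

lemma pair_word_kink_left:
  assumes "triangle_move a c d"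
  shows "tangle_eq [opp q, opp p] (cups 0 p q @ shift 2 (pair_word a b c d) @ caps 0)
    [(0, Cross d), (0, Cross a)]"
  (is "tangle_eq ?s _ _")
proof -
  have "tangle_eq ?s (cups 0 p q @ shift 2 (pair_word a b c d) @ caps 0)
    [(0, Cup p), (1, Cross a), (1, Cup q), (2, Cross b), (4, Cross c), (3, Cross d), (1, Cap), (0, Cap)]"
    by (rule tangle_eq_step[of 2 1 _ 2]) (simp_all add: local_exchange)
  also have "tangle_eq ?s \<dots>
    [(0, Cup p), (1, Cross a), (1, Cup q), (2, Cross b), (4, Cross c), (1, Cap), (1, Cross d), (0, Cap)]"
    by (rule tangle_eq_step[of 2 5 _ 2]) (simp_all add: local_exchange)
  also have "tangle_eq ?s \<dots>
    [(0, Cup p), (1, Cross a), (1, Cup q), (2, Cross b), (1, Cap), (2, Cross c), (1, Cross d), (0, Cap)]"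
    by (rule tangle_eq_step[of 2 4 _ 2]) (simp_all add: local_exchange)
  also have "tangle_eq ?s \<dots> [(0, Cup p), (1, Cross a), (2, Cross c), (1, Cross d), (0, Cap)]"
    by (rule tangle_eq_step[of 3 2 _ 0]) (simp_all add: local_move_simps)
  also have "tangle_eq ?s \<dots> [(0, Cup p), (2, Cross d), (1, Cross c), (2, Cross a), (0, Cap)]"
    by (rule tangle_eq_step[of 3 1 _ 3]) (simp_all add: local_move_simps assms)
  also have "tangle_eq ?s \<dots> [(0, Cross d), (0, Cup p), (1, Cross c), (2, Cross a), (0, Cap)]"
    by (rule tangle_eq_step[of 2 0 _ 2]) (simp_all add: local_exchange)
  also have "tangle_eq ?s \<dots> [(0, Cross d), (0, Cup p), (1, Cross c), (0, Cap), (0, Cross a)]"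
    by (rule tangle_eq_step[of 2 3 _ 2]) (simp_all add: local_exchange)
  also have "tangle_eq ?s \<dots> [(0, Cross d), (0, Cross a)]"
    by (rule tangle_eq_step[of 3 1 _ 0]) (simp_all add: local_move_simps)
  finally show ?thesis .
qed

lemma pair_straighten_left:
  "tangle_eq [opp q, opp p] (cups 2 p q @ caps 0) []"
proof -
  have "tangle_eq [opp q, opp p] (cups 2 p q @ caps 0) [(2, Cup p), (1, Cap), (1, Cup q), (0, Cap)]"
    by (rule tangle_eq_step[of 2 1 _ 2]) (simp_all add: local_exchange)
  also have "tangle_eq [opp q, opp p] \<dots> [(1, Cup q), (0, Cap)]"
    by (rule tangle_eq_step[of 2 0 _ 0]) (simp_all add: local_move_simps)
  also have "tangle_eq [opp q, opp p] \<dots> []"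
    by (rule tangle_eq_step[of 2 0 _ 0]) (simp_all add: local_move_simps)
  finally show ?thesis .
qed

lemma pair_straighten_right:
  "tangle_eq [p, q] (cups 0 p q @ caps 2) []"
proof -
  have "tangle_eq [p, q] (cups 0 p q @ caps 2) [(0, Cup p), (1, Cap), (1, Cup q), (2, Cap)]"
    by (rule tangle_eq_step[of 2 1 _ 2]) (simp_all add: local_exchange)
  also have "tangle_eq [p, q] \<dots> [(1, Cup q), (2, Cap)]"
    by (rule tangle_eq_step[of 2 0 _ 0]) (simp_all add: local_move_simps)
  also have "tangle_eq [p, q] \<dots> []"
    by (rule tangle_eq_step[of 2 0 _ 0]) (simp_all add: local_move_simps)
  finally show ?thesis .
qed

text \<open>The maximum lies on the pair that falls through the crossing on the left-hand side. If
  this pair is over, as in the second statement, the crossing moves to its other leg, whence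
  \<open>opp d\<close>.\<close>

lemma over_crossing_cap_through:
  "tangle_eq [p, q, r, s, opp q, opp p] (shift 2 (over_crossing RisingOver d) @ caps 0)
     (over_crossing FallingOver d @ caps 2)"
  "tangle_eq [p, q, r, s, opp q, opp p] (shift 2 (over_crossing FallingOver d) @ caps 0)
     (over_crossing RisingOver (opp d) @ caps 2)"
  using pair_word_cap_through[of p q r s]
    pair_word_cap_through[of p q r s RisingOver Virtual RisingOver Virtual]
    pair_word_cap_through[of p q r s Virtual RisingOver Virtual RisingOver]
    pair_word_cap_through[of p q r s Virtual Virtual FallingOver FallingOver]
    pair_word_cap_through[of p q r s FallingOver FallingOver Virtual Virtual]
  by (cases d; simp)+

lemma over_crossing_cup_through:
  "tangle_eq [r, s] (cups 0 p q @ shift 2 (over_crossing FallingOver d))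
     (cups 2 p q @ over_crossing RisingOver d)"
  "tangle_eq [r, s] (cups 0 p q @ shift 2 (over_crossing RisingOver d))
     (cups 2 p q @ over_crossing FallingOver (opp d))"
  using pair_word_cup_through[of r s p q RisingOver Virtual RisingOver Virtual]
    pair_word_cup_through[of r s p q Virtual RisingOver Virtual RisingOver]
    pair_word_cup_through[of r s p q Virtual Virtual FallingOver FallingOver]
    pair_word_cup_through[of r s p q FallingOver FallingOver Virtual Virtual]
  by (cases d; simp)+

text \<open>The remaining crossings, one virtual and one with R over L, form a twist. The strands at
  a kink crossing have equal orientations, so it is positive exactly if the rising strand is over;
  the residue is thus inverse to the twist prescribed by the sign.\<close>

lemma over_crossing_kink_right:
  assumes "k \<noteq> Virtual"
  shows "tangle_eq [p, q] (cups 2 p q @ over_crossing k d @ caps 2) (twist (k = FallingOver) d 0)"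
proof -
  have kink: "tangle_eq [p, q] (cups 2 p q @ pair_word a b c d @ caps 2) [(0, Cross d), (0, Cross a)]"
    if "triangle_move d b a" for a b c d
    using pair_word_kink_right[OF that] .
  show ?thesis
    using assms kink[where a = RisingOver and b = Virtual and c = RisingOver and d = Virtual]
      kink[where a = Virtual and b = RisingOver and c = Virtual and d = RisingOver]
      kink[where a = Virtual and b = Virtual and c = FallingOver and d = FallingOver]
      kink[where a = FallingOver and b = FallingOver and c = Virtual and d = Virtual]
    by (cases k; cases d)
      (simp_all add: triangle_move_over triangle_move_under_over triangle_move_virtual_strand)
qed

lemma over_crossing_kink_left:
  assumes "k \<noteq> Virtual"
  shows "tangle_eq [opp q, opp p] (cups 0 p q @ shift 2 (over_crossing k d) @ caps 0)
    (twist (k = FallingOver) d 0)"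
proof -
  have kink: "tangle_eq [opp q, opp p] (cups 0 p q @ shift 2 (pair_word a b c d) @ caps 0) [(0, Cross d), (0, Cross a)]"
    if "triangle_move a c d" for a b c d
    using pair_word_kink_left[OF that] .
  show ?thesis
    using assms kink[where a = RisingOver and b = Virtual and c = RisingOver and d = Virtual]
      kink[where a = Virtual and b = RisingOver and c = Virtual and d = RisingOver]
      kink[where a = Virtual and b = Virtual and c = FallingOver and d = FallingOver]
      kink[where a = FallingOver and b = FallingOver and c = Virtual and d = Virtual]
    by (cases k; cases d)
      (simp_all add: triangle_move_over triangle_move_under_over triangle_move_virtual_strand)
qed

lemma braid_eq_in_tangle:
  assumes "braid_eq n m m'" "list_all (crossing_below n) m" "length t = n"
    "layers_top u s = Some (a @ t @ b)"
    "w = u @ shift (length a) m @ v" "w' = u @ shift (length a) m' @ v"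
  shows "tangle_eq s w w'"
  using tangle_eq_in[OF braid_eq_imp_tangle_eq[OF assms(1-3)] assms(4-6)] .

lemma twist_past_caps:
  "tangle_eq [a, b, opp b, opp a, c, e] (caps 0 @ twist p d 0) (twist p d 4 @ caps 0)"
  "tangle_eq [c, e, a, b, opp b, opp a] (twist p d 0 @ caps 2) (caps 2 @ twist p d 0)"
  using tangle_eq_exchange[of "caps 0" "[a, b, opp b, opp a]" "[]" "twist p d 0" "[c, e]" "[c, e]" "[]"]
    tangle_eq_exchange[of "twist p d 0" "[c, e]" "[c, e]" "caps 0" "[a, b, opp b, opp a]" "[]" "[]"]
  by (simp_all add: twist_shift eval_nat_numeral)

lemma twist_past_cups:
  "tangle_eq [c, e] (cups 0 a b @ twist p d 4) (twist p d 0 @ cups 0 a b)"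
  "tangle_eq [c, e] (twist p d 0 @ cups 2 a b) (cups 2 a b @ twist p d 0)"
  using tangle_eq_exchange[of "cups 0 a b" "[]" "[a, b, opp b, opp a]" "twist p d 0" "[c, e]" "[c, e]" "[]"]
    tangle_eq_exchange[of "twist p d 0" "[c, e]" "[c, e]" "cups 0 a b" "[]" "[a, b, opp b, opp a]" "[]"]
  by (simp_all add: twist_shift eval_nat_numeral)

lemma twist_far_over_crossing:
  "braid_eq 6 (twist p d 0 @ shift 2 (over_crossing c e)) (shift 2 (over_crossing c e) @ twist p d 0)"
  "braid_eq 6 (over_crossing c e @ twist p d 4) (twist p d 4 @ over_crossing c e)"
proof -
  have "list_all (crossing_below 6) (shift 2 (over_crossing c e))"
    "list_all (\<lambda>(i, _). 1 < i) (shift 2 (over_crossing c e))"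
    "list_all (crossing_below 6) (over_crossing c e)"
    "list_all (\<lambda>(i, _). i < 3) (over_crossing c e)"
    by (cases c; cases e; simp)+
  then show "braid_eq 6 (twist p d 0 @ shift 2 (over_crossing c e))
      (shift 2 (over_crossing c e) @ twist p d 0)"
    "braid_eq 6 (over_crossing c e @ twist p d 4) (twist p d 4 @ over_crossing c e)"
    by (cases p; cases d; intro braid_eq_far[where k = 1] braid_eq_far[where k = 3]; simp)+
qed

section \<open>Parallel crossings at minima, maxima and kinks\<close>

lemma par_cross_shift_below: "list_all (crossing_below 6) (shift 2 (par_cross c d e))"
  by (cases c; cases d; cases e) (simp_all add: add_twist_def pairs_crossing_def)

lemma par_cross_cap_through:
  "tangle_eq [p, q, r, s, opp q, opp p] (shift 2 (par_cross c y (opp x)) @ caps 0)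
     (par_cross (flip c) x y @ caps 2)"
  (is "tangle_eq ?s _ _")
proof (cases c)
  \<comment> \<open>The maximum is on the under pair: the twist goes over it to the other leg, where
    it is far from the crossing.\<close>
  case RisingOver
  let ?t = "twist (y = opp x)"
  have pos: "(x \<noteq> y) = (y = opp x)" by (cases x; cases y) simp_all
  have "tangle_eq ?s (shift 2 (par_cross RisingOver y (opp x)) @ caps 0)
      (shift 2 (over_crossing RisingOver y) @ ?t (opp x) 2 @ caps 0)"
    by (rule braid_eq_in_tangle[OF braid_eq_shift[OF par_cross_RisingOver(1)[of y "opp x"], of 2 6]
          par_cross_shift_below, where u = "[]" and a = "[]" and b = "[]" and v = "caps 0"])
      (simp_all add: twist_shift eval_nat_numeral)
  also have "tangle_eq ?s \<dots> (shift 2 (over_crossing RisingOver y) @ ?t x 0 @ caps 0)"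
    by (rule tangle_eq_in[OF tangle_eq.sym[OF twist_over_caps[of p q "y = opp x" x]],
          where u = "shift 2 (over_crossing RisingOver y)" and a = "[]" and b = "[r, s]" and v = "[]"])
      simp_all
  also have "tangle_eq ?s \<dots> (?t x 0 @ shift 2 (over_crossing RisingOver y) @ caps 0)"
    by (rule tangle_eq.sym, rule braid_eq_in_tangle[OF twist_far_over_crossing(1)[of "y = opp x" x RisingOver y],
          where t = "[p, q, r, s, opp q, opp p]" and u = "[]" and a = "[]" and b = "[]"
          and v = "caps 0"])
      (cases x; cases y; simp)+
  also have "tangle_eq ?s \<dots> (?t x 0 @ over_crossing FallingOver y @ caps 2)"
    by (rule tangle_eq.above[OF _ over_crossing_cap_through(1)])
      (cases x; cases y; simp)
  also have "tangle_eq ?s \<dots> (par_cross FallingOver x y @ caps 2)"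
    by (rule tangle_eq.sym, rule braid_eq_in_tangle[OF par_cross_FallingOver(2)[of x y]
          par_cross_below, where t = "[p, q, r, s]" and u = "[]" and a = "[]"
          and b = "[opp q, opp p]" and v = "caps 2"])
      (simp_all add: pos)
  finally show ?thesis by (simp add: RisingOver)
next
  \<comment> \<open>The maximum is on the over pair: the twist, on the pair running through, is
    lifted above the maxima while the crossing moves, and is then lowered again.\<close>
  case FallingOver
  let ?t = "twist (y = x) y"
  have pos: "(y \<noteq> opp x) = (y = x)" "(x = y) = (y = x)" by (cases x; cases y; simp)+
  have "tangle_eq ?s (shift 2 (par_cross FallingOver y (opp x)) @ caps 0)
      (shift 2 (over_crossing FallingOver (opp x)) @ ?t 4 @ caps 0)"
    by (rule braid_eq_in_tangle[OF braid_eq_shift[OF par_cross_FallingOver(1)[of y "opp x"], of 2 6]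
          par_cross_shift_below, where u = "[]" and a = "[]" and b = "[]" and v = "caps 0"])
      (simp_all add: twist_shift pos eval_nat_numeral)
  also have "tangle_eq ?s \<dots> (shift 2 (over_crossing FallingOver (opp x)) @ caps 0 @ ?t 0)"
    by (rule tangle_eq.above[OF _ tangle_eq.sym[OF twist_past_caps(1)[of p q r s]]])
      simp
  also have "\<dots> = (shift 2 (over_crossing FallingOver (opp x)) @ caps 0) @ ?t 0" by simp
  also have "tangle_eq ?s \<dots> ((over_crossing RisingOver x @ caps 2) @ ?t 0)"
    using tangle_eq.below[OF over_crossing_cap_through(2)[of p q r s "opp x"]] by simp
  also have "\<dots> = over_crossing RisingOver x @ caps 2 @ ?t 0" by simp
  also have "tangle_eq ?s \<dots> (over_crossing RisingOver x @ ?t 0 @ caps 2)"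
    by (rule tangle_eq.above[OF _ tangle_eq.sym[OF twist_past_caps(2)[of r s p q]]])
      simp
  also have "tangle_eq ?s \<dots> (par_cross RisingOver x y @ caps 2)"
    by (rule tangle_eq.sym, rule braid_eq_in_tangle[OF par_cross_RisingOver(1)[of x y]
          par_cross_below, where t = "[p, q, r, s]" and u = "[]" and a = "[]"
          and b = "[opp q, opp p]" and v = "caps 2"])
      (simp_all add: pos)
  finally show ?thesis by (simp add: FallingOver)
next
  case Virtual
  then show ?thesis
    using pair_word_cap_through[of p q r s Virtual Virtual Virtual Virtual]
    by (simp add: par_cross_Virtual[of _ _ Up] del: parallel_crossing.simps)
qed

text \<open>At a minimum one starts from the form with the twist below the crossing, next to the
  minima. It slides around them if the minimum is on the under pair, and is otherwise lowered below
  them for the time being.\<close>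

lemma par_cross_cup_through:
  "tangle_eq [r, s] (cups 0 p q @ shift 2 (par_cross c (opp x) y))
     (cups 2 p q @ par_cross (flip c) y x)"
proof (cases c)
  case RisingOver
  let ?t = "twist (y = opp x) y"
  have pos: "(opp x = y) = (y = opp x)" "(y \<noteq> x) = (y = opp x)" by (cases x; cases y; simp)+
  have "tangle_eq [r, s] (cups 0 p q @ shift 2 (par_cross RisingOver (opp x) y))
      (cups 0 p q @ ?t 4 @ shift 2 (over_crossing RisingOver (opp x)))"
    by (rule braid_eq_in_tangle[OF braid_eq_shift[OF par_cross_RisingOver(2)[of "opp x" y], of 2 6]
          par_cross_shift_below, where t = "[p, q, opp q, opp p, r, s]" and u = "cups 0 p q"
          and a = "[]" and b = "[]" and v = "[]"])
      (simp_all add: twist_shift pos eval_nat_numeral)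
  also have "tangle_eq [r, s] \<dots> (?t 0 @ cups 0 p q @ shift 2 (over_crossing RisingOver (opp x)))"
    using tangle_eq.below[OF twist_past_cups(1)] by simp
  also have "tangle_eq [r, s] \<dots> (?t 0 @ cups 2 p q @ over_crossing FallingOver x)"
    by (rule tangle_eq.above[OF twist_top])
      (use over_crossing_cup_through(2)[of r s p q "opp x"] in simp)
  also have "tangle_eq [r, s] \<dots> (cups 2 p q @ ?t 0 @ over_crossing FallingOver x)"
    using tangle_eq.below[OF twist_past_cups(2)] by simp
  also have "tangle_eq [r, s] \<dots> (cups 2 p q @ par_cross FallingOver y x)"
    by (rule tangle_eq.sym, rule braid_eq_in_tangle[OF par_cross_FallingOver(2)[of y x]
          par_cross_below, where t = "[r, s, p, q]" and u = "cups 2 p q"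
          and a = "[]" and b = "[opp q, opp p]" and v = "[]"])
      (simp_all add: pos)
  finally show ?thesis by (simp add: RisingOver)
next
  case FallingOver
  let ?t = "twist (x = y)"
  have pos: "(opp x \<noteq> y) = (x = y)" "(y = x) = (x = y)" by (cases x; cases y; simp)+
  have "tangle_eq [r, s] (cups 0 p q @ shift 2 (par_cross FallingOver (opp x) y))
      (cups 0 p q @ ?t (opp x) 2 @ shift 2 (over_crossing FallingOver y))"
    by (rule braid_eq_in_tangle[OF braid_eq_shift[OF par_cross_FallingOver(2)[of "opp x" y], of 2 6]
          par_cross_shift_below, where t = "[p, q, opp q, opp p, r, s]" and u = "cups 0 p q"
          and a = "[]" and b = "[]" and v = "[]"])
      (simp_all add: twist_shift pos eval_nat_numeral)
  also have "tangle_eq [r, s] \<dots> (cups 0 p q @ ?t x 0 @ shift 2 (over_crossing FallingOver y))"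
    by (rule tangle_eq_in[OF tangle_eq.sym[OF twist_over_cups[of p q "x = y" x]], where u = "[]"
          and a = "[]" and b = "[r, s]" and v = "shift 2 (over_crossing FallingOver y)"])
      simp_all
  also have "tangle_eq [r, s] \<dots> (cups 0 p q @ shift 2 (over_crossing FallingOver y) @ ?t x 0)"
    by (rule braid_eq_in_tangle[OF twist_far_over_crossing(1)[of "x = y" x FallingOver y],
          where t = "[p, q, opp q, opp p, r, s]" and u = "cups 0 p q"
          and a = "[]" and b = "[]" and v = "[]"])
      (cases x; cases y; simp)+
  also have "tangle_eq [r, s] \<dots> (cups 2 p q @ over_crossing RisingOver y @ ?t x 0)"
    using tangle_eq.below[OF over_crossing_cup_through(1)[of r s p q y], of "?t x 0"] by simp
  also have "tangle_eq [r, s] \<dots> (cups 2 p q @ par_cross RisingOver y x)"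
    by (rule tangle_eq.sym, rule braid_eq_in_tangle[OF par_cross_RisingOver(1)[of y x]
          par_cross_below, where t = "[r, s, p, q]" and u = "cups 2 p q"
          and a = "[]" and b = "[opp q, opp p]" and v = "[]"])
      (simp_all add: pos)
  finally show ?thesis by (simp add: FallingOver)
next
  case Virtual
  then show ?thesis
    using pair_word_cup_through[of r s p q Virtual Virtual Virtual Virtual]
    by (simp add: par_cross_Virtual[of _ _ Up] del: parallel_crossing.simps)
qed

lemma twist_cancel:
  "tangle_eq [p, q] (twist b d 0 @ twist (\<not> b) d 0) []"
  using braid_eq_imp_tangle_eq[OF twist_inverse[of 0 2 b d]] by (simp add: twist_letters)

lemma virtual_cancel: "tangle_eq [p, q] [(0, Cross Virtual), (0, Cross Virtual)] []"
  by (rule braid_eq_imp_tangle_eq[of 2]) (auto intro!: braid_eq.move braid_move.bigon)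

text \<open>For a classical crossing, the form is chosen whose twist is on a leg leaving the kink.
  Outside, it cancels the twist to which the kink reduces. For a virtual crossing the residue is a
  virtual bigon.\<close>

lemma par_cross_kink_right:
  "tangle_eq [p, q] (cups 2 p q @ par_cross c d d @ caps 2) []"
proof (cases c)
  case RisingOver
  have "tangle_eq [p, q] (cups 2 p q @ par_cross RisingOver d d @ caps 2)
      (cups 2 p q @ over_crossing RisingOver d @ twist True d 0 @ caps 2)"
    by (rule braid_eq_in_tangle[OF par_cross_RisingOver(1)[of d d] par_cross_below,
          where t = "[p, q, p, q]" and u = "cups 2 p q"
          and a = "[]" and b = "[opp q, opp p]" and v = "caps 2"]) simp_all
  also have "tangle_eq [p, q] \<dots> (cups 2 p q @ over_crossing RisingOver d @ caps 2 @ twist True d 0)"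
    by (rule tangle_eq_in[OF twist_past_caps(2)[of p q p q True d],
          where u = "cups 2 p q @ over_crossing RisingOver d" and a = "[]" and b = "[]" and v = "[]"])
      (simp_all add: layers_top_append del: over_crossing_simps)
  also have "tangle_eq [p, q] \<dots> (twist False d 0 @ twist True d 0)"
    using tangle_eq.below[OF over_crossing_kink_right[of RisingOver p q d], of "twist True d 0"]
    by (simp del: over_crossing_simps twist_simps)
  also have "tangle_eq [p, q] \<dots> []"
    using twist_cancel[of p q False d] by simp
  finally show ?thesis by (simp add: RisingOver)
next
  case FallingOver
  have "tangle_eq [p, q] (cups 2 p q @ par_cross FallingOver d d @ caps 2)
      (cups 2 p q @ twist False d 0 @ over_crossing FallingOver d @ caps 2)"
    by (rule braid_eq_in_tangle[OF par_cross_FallingOver(2)[of d d] par_cross_below,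
          where t = "[p, q, p, q]" and u = "cups 2 p q"
          and a = "[]" and b = "[opp q, opp p]" and v = "caps 2"]) simp_all
  also have "tangle_eq [p, q] \<dots> (twist False d 0 @ cups 2 p q @ over_crossing FallingOver d @ caps 2)"
    using tangle_eq.below[OF tangle_eq.sym[OF twist_past_cups(2)[of p q False d p q]],
        of "over_crossing FallingOver d @ caps 2"]
    by (simp del: over_crossing_simps twist_simps)
  also have "tangle_eq [p, q] \<dots> (twist False d 0 @ twist True d 0)"
    by (rule tangle_eq.above[OF twist_top])
      (use over_crossing_kink_right[of FallingOver p q d] in simp)
  also have "tangle_eq [p, q] \<dots> []"
    using twist_cancel[of p q False d] by simp
  finally show ?thesis by (simp add: FallingOver)
next
  case Virtual
  have "tangle_eq [p, q] (cups 2 p q @ par_cross Virtual d d @ caps 2)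
      [(0, Cross Virtual), (0, Cross Virtual)]"
    using pair_word_kink_right[OF triangle_move_virtual_strand(1)[of Virtual], of p q Virtual]
    by (simp add: par_cross_Virtual[of _ _ Up] del: parallel_crossing.simps)
  also note virtual_cancel
  finally show ?thesis by (simp add: Virtual)
qed

lemma par_cross_kink_left:
  "tangle_eq [opp q, opp p] (cups 0 p q @ shift 2 (par_cross c d d) @ caps 0) []"
  (is "tangle_eq ?s _ _")
proof (cases c)
  case RisingOver
  have "tangle_eq ?s (cups 0 p q @ shift 2 (par_cross RisingOver d d) @ caps 0)
      (cups 0 p q @ twist True d 4 @ shift 2 (over_crossing RisingOver d) @ caps 0)"
    by (rule braid_eq_in_tangle[OF braid_eq_shift[OF par_cross_RisingOver(2)[of d d], of 2 6]
          par_cross_shift_below, where t = "[p, q, opp q, opp p, opp q, opp p]"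
          and u = "cups 0 p q" and a = "[]" and b = "[]" and v = "caps 0"])
      (simp_all add: twist_shift eval_nat_numeral del: twist_simps)
  also have "tangle_eq ?s \<dots> (twist True d 0 @ cups 0 p q @ shift 2 (over_crossing RisingOver d) @ caps 0)"
    using tangle_eq.below[OF twist_past_cups(1)[of "opp q" "opp p" p q True d],
        of "shift 2 (over_crossing RisingOver d) @ caps 0"]
    by (simp del: over_crossing_simps twist_simps)
  also have "tangle_eq ?s \<dots> (twist True d 0 @ twist False d 0)"
    by (rule tangle_eq.above[OF twist_top])
      (use over_crossing_kink_left[of RisingOver q p d] in simp)
  also have "tangle_eq ?s \<dots> []"
    using twist_cancel[of "opp q" "opp p" True d] by simp
  finally show ?thesis by (simp add: RisingOver)
next
  case FallingOver
  have "tangle_eq ?s (cups 0 p q @ shift 2 (par_cross FallingOver d d) @ caps 0)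
      (cups 0 p q @ shift 2 (over_crossing FallingOver d) @ twist False d 4 @ caps 0)"
    by (rule braid_eq_in_tangle[OF braid_eq_shift[OF par_cross_FallingOver(1)[of d d], of 2 6]
          par_cross_shift_below, where t = "[p, q, opp q, opp p, opp q, opp p]"
          and u = "cups 0 p q" and a = "[]" and b = "[]" and v = "caps 0"])
      (simp_all add: twist_shift eval_nat_numeral del: twist_simps)
  also have "tangle_eq ?s \<dots>
      (cups 0 p q @ shift 2 (over_crossing FallingOver d) @ caps 0 @ twist False d 0)"
    by (rule tangle_eq_in[OF tangle_eq.sym[OF twist_past_caps(1)[of p q "opp q" "opp p" False d]],
          where u = "cups 0 p q @ shift 2 (over_crossing FallingOver d)" and a = "[]" and b = "[]"
          and v = "[]"])
      (simp_all add: layers_top_append del: over_crossing_simps twist_simps)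
  also have "tangle_eq ?s \<dots> (twist True d 0 @ twist False d 0)"
    using tangle_eq.below[OF over_crossing_kink_left[of FallingOver q p d], of "twist False d 0"]
    by (simp del: over_crossing_simps twist_simps)
  also have "tangle_eq ?s \<dots> []"
    using twist_cancel[of "opp q" "opp p" True d] by simp
  finally show ?thesis by (simp add: FallingOver)
next
  case Virtual
  have "tangle_eq ?s (cups 0 p q @ shift 2 (par_cross Virtual d d) @ caps 0)
      [(0, Cross Virtual), (0, Cross Virtual)]"
    using pair_word_kink_left[OF triangle_move_virtual_strand(1)[of Virtual], of q p Virtual]
    by (simp add: par_cross_Virtual[of _ _ Up] del: parallel_crossing.simps)
  also note virtual_cancel
  finally show ?thesis by (simp add: Virtual)
qed

section \<open>Parallel diagrams\<close>

definition par :: "(orientation \<Rightarrow> orientation) \<Rightarrow> orientation \<Rightarrow> orientation list" where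
  "par f d = (if d = Up then [f d, d] else [d, f d])"

definition doubled :: "(orientation \<Rightarrow> orientation) \<Rightarrow> orientation list \<Rightarrow> orientation list" where
  "doubled f s = concat (map (par f) s)"

lemma doubled_simps [simp]:
  "doubled f [] = []"
  "doubled f (d # s) = par f d @ doubled f s"
  "doubled f (s @ t) = doubled f s @ doubled f t"
  by (simp_all add: doubled_def)

lemma length_par [simp]: "length (par f d) = 2"
  by (simp add: par_def)

lemma length_doubled [simp]: "length (doubled f s) = 2 * length s"
  by (induction s) simp_all

lemma parallel_layer_frame:
  assumes "i + strands_below p \<le> length s"
  shows "parallel_layer f (length a + i, p) (a @ s @ b) =
    shift (2 * length a) (parallel_layer f (i, p) s)"
proof (cases p)
  case (Cup d)
  then show ?thesis by (cases d) simp_all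
next
  case (Cross c)
  then show ?thesis
    using assms par_cross_shift[of "length a + i"] par_cross_shift[of i]
    by (simp add: nth_append)
qed simp

text \<open>Doubling reads orientations only at the strands of the piece, so further strands on the
  left merely translate the result.\<close>

lemma parallel_layers_frame:
  "layers_top w s = Some t \<Longrightarrow>
   parallel_layers f (shift (length a) w) (a @ s @ b) = shift (2 * length a) (parallel_layers f w s)"
proof (induction w arbitrary: s)
  case (Cons l w)
  obtain i p where l: "l = (i, p)" by (cases l)
  from Cons.prems obtain r where r: "layer_top (i, p) s = Some r" "layers_top w r = Some t"
    by (auto simp: l bind_eq_Some_conv)
  then show ?case
    using parallel_layer_frame[of i p s] layer_top_length[OF r(1)] layer_top_frame[OF r(1), of a b]
      Cons.IH[OF r(2)]
    by (simp add: l)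
qed simp

lemma parallel_layers_append:
  "layers_top u s = Some t \<Longrightarrow>
   parallel_layers f (u @ v) s = parallel_layers f u s @ parallel_layers f v t"
  by (induction u arbitrary: s) (auto simp: bind_eq_Some_conv)

lemma layer_top_split:
  assumes "layer_top (i, p) s = Some t"
  obtains a c c' b where "s = a @ c @ b" "t = a @ c' @ b" "length a = i"
    "length c = strands_below p" "layer_top (0, p) c = Some c'"
proof (cases p)
  case (Cup d)
  then show ?thesis
    using assms that[of "take i s" "[]" "drop i s" "[d, opp d]"] by (simp split: if_splits)
next
  case Cap
  then show ?thesis
    using assms that[of "take i s" "[s ! i, s ! (i + 1)]" "drop (i + 2) s" "[]"] split_two[of i s]
    by (simp split: if_splits)
next
  case (Cross c)
  then show ?thesis
    using assms that[of "take i s" "[s ! i, s ! (i + 1)]" "drop (i + 2) s" "[s ! (i + 1), s ! i]"]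
      split_two[of i s]
    by (simp split: if_splits)
qed

lemma par_cross_top [simp]: "layers_top (par_cross c d e) [w, x, y, z] = Some [y, z, w, x]"
  by (cases c; cases d; cases e) (simp_all add: add_twist_def pairs_crossing_def)

text \<open>Hides \<open>f\<close> and the direction of the strand: the arms of a doubled minimum
  read \<open>p\<close>, \<open>q\<close> and \<open>opp q\<close>, \<open>opp p\<close>, as nested
  minima demand. The hypothesis holds for the identity and for \<open>opp\<close>.\<close>

lemma par_eq:
  assumes "\<And>d. f (opp d) = opp (f d)"
  shows "\<exists>p q. par f d = [p, q] \<and> par f (opp d) = [opp q, opp p] \<and>
    (\<forall>i s. parallel_layer f (i, Cup d) s = cups (2 * i) p q)"
  using assms[of Up] by (cases d) (simp_all add: par_def)

lemma length_eq_2_iff: "length s = 2 \<longleftrightarrow> (\<exists>x y. s = [x, y])"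
  by (auto simp: numeral_2_eq_2 length_Suc_conv)

text \<open>Each piece is treated on its own strands and then framed by its doubled neighbours. With
  empty ends this says that parallels of diagrams are diagrams.\<close>

lemma parallel_layers_top:
  assumes "\<And>d. f (opp d) = opp (f d)"
  shows "layers_top w s = Some t \<Longrightarrow>
    layers_top (parallel_layers f w s) (doubled f s) = Some (doubled f t)"
proof (induction w arbitrary: s)
  case (Cons l w)
  obtain i p where l: "l = (i, p)" by (cases l)
  from Cons.prems obtain r where r: "layer_top (i, p) s = Some r" "layers_top w r = Some t"
    by (auto simp: l bind_eq_Some_conv)
  obtain a c c' b where abc: "s = a @ c @ b" "r = a @ c' @ b" "length a = i"
    "length c = strands_below p" "layer_top (0, p) c = Some c'"
    by (rule layer_top_split[OF r(1)])
  have "layers_top (parallel_layer f (0, p) c) (doubled f c) = Some (doubled f c')"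
  proof (cases p)
    case (Cup d)
    obtain x y where xy: "par f d = [x, y]" "par f (opp d) = [opp y, opp x]"
      "\<forall>i s. parallel_layer f (i, Cup d) s = cups (2 * i) x y"
      using par_eq[where f = f and d = d, OF assms] by blast
    have "c = []" "c' = [d, opp d]" using abc(4,5) Cup by simp_all
    then show ?thesis by (simp add: Cup xy)
  next
    case Cap
    then obtain d e where "c = [d, e]" using abc(4) by (auto simp: length_eq_2_iff)
    then have "c = [d, opp d]" "c' = []" using abc(5) Cap by (simp_all split: if_splits)
    moreover obtain x y where xy: "par f d = [x, y]" "par f (opp d) = [opp y, opp x]"
      "\<forall>i s. parallel_layer f (i, Cup d) s = cups (2 * i) x y"
      using par_eq[where f = f and d = d, OF assms] by blast
    ultimately show ?thesis by (simp add: Cap xy)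
  next
    case (Cross k)
    then obtain d e where "c = [d, e]" using abc(4) by (auto simp: length_eq_2_iff)
    then have "c = [d, e]" "c' = [e, d]" using abc(5) Cross by simp_all
    moreover obtain x y where xy: "par f d = [x, y]" "par f (opp d) = [opp y, opp x]"
      "\<forall>i s. parallel_layer f (i, Cup d) s = cups (2 * i) x y"
      using par_eq[where f = f and d = d, OF assms] by blast
    moreover obtain x' y' where xy': "par f e = [x', y']" "par f (opp e) = [opp y', opp x']"
      "\<forall>i s. parallel_layer f (i, Cup e) s = cups (2 * i) x' y'"
      using par_eq[where f = f and d = e, OF assms] by blast
    ultimately show ?thesis by (simp add: Cross xy xy')
  qed
  from layers_top_frame[OF this, of "doubled f a" "doubled f b"]
  have "layers_top (parallel_layer f l s) (doubled f s) = Some (doubled f r)"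
    using parallel_layer_frame[of 0 p c f a b] abc by (simp add: l)
  then show ?case using r Cons.IH[OF r(2)] by (simp add: l layers_top_append)
qed simp

text \<open>The common top \<open>t\<close> is included because the layers above a move are doubled
  according to it.\<close>

definition parallel_eq where
  "parallel_eq f s m m' \<longleftrightarrow> (\<exists>t. layers_top m s = Some t \<and> layers_top m' s = Some t \<and>
     tangle_eq (doubled f s) (parallel_layers f m s) (parallel_layers f m' s))"

lemma parallel_eq_frame:
  assumes "parallel_eq f s m m'" "length a = i"
  shows "parallel_eq f (a @ s @ b) (shift i m) (shift i m')"
proof -
  obtain t where t: "layers_top m s = Some t" "layers_top m' s = Some t"
    "tangle_eq (doubled f s) (parallel_layers f m s) (parallel_layers f m' s)"
    using assms(1) by (auto simp: parallel_eq_def)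
  show ?thesis
    unfolding parallel_eq_def assms(2)[symmetric]
    using layers_top_frame[OF t(1)] layers_top_frame[OF t(2)] parallel_layers_frame[OF t(1)]
      parallel_layers_frame[OF t(2)] tangle_eq_frame[OF t(3), of "doubled f a" "doubled f b"]
    by simp
qed

text \<open>Both pieces and their distance are arbitrary. The list \<open>s\<close> is therefore cut
  into the strands at \<open>p\<close>, the \<open>k\<close> strands between, those at
  \<open>q\<close> and the rest, and the doubled pieces exchange by
  \<open>tangle_eq_exchange\<close>.\<close>

lemma parallel_eq_exchange:
  assumes f: "\<And>d. f (opp d) = opp (f d)"
    and "layers_top [(i, p), (i + strands_above p + k, q)] s = Some t"
  shows "parallel_eq f s [(i, p), (i + strands_above p + k, q)] [(i + strands_below p + k, q), (i, p)]"
proof -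
  obtain r where r: "layer_top (i, p) s = Some r"
    "layer_top (i + strands_above p + k, q) r = Some t"
    using assms(2) by (auto simp: bind_eq_Some_conv simp del: layer_top.simps)
  obtain a c c' b where abc: "s = a @ c @ b" "r = a @ c' @ b" "length a = i"
    "length c = strands_below p" "layer_top (0, p) c = Some c'"
    by (rule layer_top_split[OF r(1)])
  obtain a2 e e' b2 where abc2: "r = a2 @ e @ b2" "t = a2 @ e' @ b2"
    "length a2 = i + strands_above p + k"
    "length e = strands_below q" "layer_top (0, q) e = Some e'"
    by (rule layer_top_split[OF r(2)])
  have c': "length c' = strands_above p" using layer_top_length[OF abc(5)] abc(4) by simp
  \<comment> \<open>The strands between the pieces are read off at the height between the two
    layers, where those left of \<open>q\<close> are known from both splittings of
    \<open>r\<close>.\<close>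
  define mid where "mid = drop (i + strands_above p) a2"
  have "take (i + strands_above p) r = a @ c'" using abc(2,3) c' by simp
  moreover have "take (i + strands_above p) r = take (i + strands_above p) a2"
    using abc2(1,3) by simp
  ultimately have "a2 = (a @ c') @ mid" unfolding mid_def by (metis append_take_drop_id)
  then have b: "b = mid @ e @ b2" and mid: "length mid = k"
    using abc(2) abc2(1,3) abc(3) c' by auto
  have base: "parallel_eq f (c @ mid @ e) [(0, p), (strands_above p + k, q)]
    [(strands_below p + k, q), (0, p)]"
  proof -
    have tops: "layers_top (parallel_layer f (0, p) c) (doubled f c) = Some (doubled f c')"
      "layers_top (parallel_layer f (0, q) e) (doubled f e) = Some (doubled f e')"
      using parallel_layers_top[where f = f and w = "[(0, p)]" and s = c, OF f]
        parallel_layers_top[where f = f and w = "[(0, q)]" and s = e, OF f] abc(5) abc2(5)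
      by simp_all
    have lt: "layer_top (0, p) (c @ x) = Some (c' @ x)" for x
      using layer_top_frame[OF abc(5), of "[]" x] by simp
    have lq: "layer_top (length x + k, q) (x @ mid @ e) = Some (x @ mid @ e')" for x
      using layer_top_frame[OF abc2(5), of "x @ mid" "[]"] mid by simp
    have pp: "parallel_layer f (0, p) (c @ x) = parallel_layer f (0, p) c" for x
      using parallel_layer_frame[of 0 p c f "[]" x] abc(4) by simp
    have pq: "parallel_layer f (length x + k, q) (x @ mid @ e) =
      shift (2 * (length x + k)) (parallel_layer f (0, q) e)" for x
      using parallel_layer_frame[of 0 q e f "x @ mid" "[]"] abc2(4) mid by simp
    show ?thesis
      using tangle_eq_exchange[OF tops, of "doubled f mid"]
        lt[of "mid @ e"] lt[of "mid @ e'"] lq[of c] lq[of c'] pp[of "mid @ e"] pp[of "mid @ e'"]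
        pq[of c] pq[of c'] abc(4) c' mid
      by (simp add: parallel_eq_def algebra_simps del: layer_top.simps parallel_layer.simps)
  qed
  from parallel_eq_frame[OF base abc(3), of b2] show ?thesis
    by (simp add: abc(1) b add.assoc)
qed

section \<open>Parallels of local moves\<close>

text \<open>Only the number of strands is tracked: the word stays within \<open>n\<close> of them.
  Otherwise a framed word could fit by using neighbours on the right although the unframed word does
  not fit.\<close>

fun fits :: "layers \<Rightarrow> nat \<Rightarrow> bool" where
  "fits [] n \<longleftrightarrow> True"
| "fits ((i, p) # w) n \<longleftrightarrow>
     i + strands_below p \<le> n \<and> fits w (n - strands_below p + strands_above p)"

lemma layers_top_frame_iff:
  "fits w (length s) \<Longrightarrow>
   layers_top (shift (length a) w) (a @ s @ b) = map_option (\<lambda>t. a @ t @ b) (layers_top w s)"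
proof (induction w arbitrary: s)
  case (Cons l w)
  obtain i p where l: "l = (i, p)" by (cases l)
  show ?case
  proof (cases "layer_top (i, p) s")
    case None
    moreover have "i + strands_below p \<le> length s" using Cons.prems by (simp add: l)
    ultimately have "layer_top (length a + i, p) (a @ s @ b) = None"
      by (cases p) (auto simp: nth_append add.assoc split: if_splits)
    with None show ?thesis by (simp add: l)
  next
    case (Some r)
    have "length r = length s - strands_below p + strands_above p"
      using layer_top_length[OF Some] by arith
    then have "fits w (length r)" using Cons.prems by (simp only: l fits.simps)
    from Cons.IH[OF this] show ?thesis
      using Some layer_top_frame[OF Some, of a b] by (simp add: l)
  qed
qed simp

text \<open>Reduces a move at position \<open>i\<close> to position 0 on exactly \<open>n\<close>
  strands, its width; by \<open>fits\<close>, what fits inside the diagram fits there as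
  well.\<close>

lemma parallel_eq_local:
  assumes "layers_top (shift i m) s = Some t" "i + n \<le> length s" "fits m n"
    "\<And>c r. \<lbrakk>length c = n; layers_top m c = Some r\<rbrakk> \<Longrightarrow> parallel_eq f c m m'"
  shows "parallel_eq f s (shift i m) (shift i m')"
proof -
  define a c b where "a = take i s" and "c = take n (drop i s)" and "b = drop (i + n) s"
  have s: "s = a @ c @ b" unfolding a_def b_def c_def
    by (metis append_take_drop_id drop_drop add.commute)
  have len: "length a = i" "length c = n" using assms(2) by (auto simp: a_def c_def)
  obtain r where "layers_top m c = Some r"
    using assms(1,3) layers_top_frame_iff[of m c a b] len
    by (cases "layers_top m c") (auto simp: s)
  then show ?thesis unfolding s
    by (intro parallel_eq_frame assms(4) len)
qed

context
  fixes f :: "orientation \<Rightarrow> orientation"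
  assumes f_opp: "f (opp d) = opp (f d)"
begin

lemma par_cases:
  obtains p q where "par f d = [p, q]" "par f (opp d) = [opp q, opp p]"
    "\<forall>i s. parallel_layer f (i, Cup d) s = cups (2 * i) p q"
  using par_eq[where f = f and d = d, OF f_opp] by blast

lemma parallel_eq_straighten:
  "parallel_eq f [opp d] [(1, Cup d), (0, Cap)] []"
  "parallel_eq f [d] [(0, Cup d), (1, Cap)] []"
proof -
  obtain p q where par: "par f d = [p, q]" "par f (opp d) = [opp q, opp p]"
    "\<forall>i s. parallel_layer f (i, Cup d) s = cups (2 * i) p q"
    by (rule par_cases)
  show "parallel_eq f [opp d] [(1, Cup d), (0, Cap)] []"
    using pair_straighten_left[of q p] by (simp add: parallel_eq_def par eval_nat_numeral)
  show "parallel_eq f [d] [(0, Cup d), (1, Cap)] []"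
    using pair_straighten_right[of p q] by (simp add: parallel_eq_def par eval_nat_numeral)
qed

lemma parallel_eq_cap_through:
  "parallel_eq f [x, y, opp x] [(1, Cross c), (0, Cap)] [(0, Cross (flip c)), (1, Cap)]"
proof -
  obtain p q where par: "par f x = [p, q]" "par f (opp x) = [opp q, opp p]"
    "\<forall>i s. parallel_layer f (i, Cup x) s = cups (2 * i) p q"
    by (rule par_cases)
  obtain r s where "par f y = [r, s]" "par f (opp y) = [opp s, opp r]"
    "\<forall>i s'. parallel_layer f (i, Cup y) s' = cups (2 * i) r s"
    by (rule par_cases)
  with par show ?thesis
    using par_cross_cap_through[of p q r s c y x] par_cross_shift[of 1]
    by (simp add: parallel_eq_def eval_nat_numeral)
qed

lemma parallel_eq_cup_through:
  "parallel_eq f [y] [(0, Cup x), (1, Cross c)] [(1, Cup x), (0, Cross (flip c))]"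
proof -
  obtain p q where par: "par f x = [p, q]" "par f (opp x) = [opp q, opp p]"
    "\<forall>i s. parallel_layer f (i, Cup x) s = cups (2 * i) p q"
    by (rule par_cases)
  obtain r s where "par f y = [r, s]" "par f (opp y) = [opp s, opp r]"
    "\<forall>i s'. parallel_layer f (i, Cup y) s' = cups (2 * i) r s"
    by (rule par_cases)
  with par show ?thesis
    using par_cross_cup_through[of r s p q c x y] par_cross_shift[of 1]
    by (simp add: parallel_eq_def eval_nat_numeral)
qed

lemma parallel_eq_kink:
  "parallel_eq f [d] (kink_right 0 d c) []"
  "parallel_eq f [opp d] (kink_left 0 d c) []"
proof -
  obtain p q where par: "par f d = [p, q]" "par f (opp d) = [opp q, opp p]"
    "\<forall>i s. parallel_layer f (i, Cup d) s = cups (2 * i) p q"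
    by (rule par_cases)
  show "parallel_eq f [d] (kink_right 0 d c) []"
    using par_cross_kink_right[of p q c d]
    by (simp add: parallel_eq_def kink_right_def par eval_nat_numeral)
  \<comment> \<open>The crossing involves the right arm of the minimum, so both strands at it are
    oriented \<open>opp d\<close>.\<close>
  show "parallel_eq f [opp d] (kink_left 0 d c) []"
    using par_cross_kink_left[of q p c "opp d"] par_cross_shift[of 1]
    by (simp add: parallel_eq_def kink_left_def par eval_nat_numeral)
qed

lemma parallel_eq_bigon: "parallel_eq f [x, y] (bigon 0 c) []"
proof -
  have "tangle_eq (doubled f [x, y]) (par_cross c x y @ par_cross (flip c) y x) []"
    using par_cross_below by (intro braid_eq_imp_tangle_eq[OF par_cross_inverse]) simp_all
  then show ?thesis by (simp add: parallel_eq_def bigon_def)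
qed

lemma parallel_eq_triangle:
  assumes "par_triangle a b c x y z"
  shows "parallel_eq f [x, y, z] (triangle 0 a b c) (triangle' 0 a b c)"
proof -
  have below: "list_all (crossing_below 6) (par_cross c d e)" for c d e
    by (cases c; cases d; cases e) (simp_all add: add_twist_def pairs_crossing_def)
  have "tangle_eq (doubled f [x, y, z])
      (par_cross a x y @ shift 2 (par_cross b x z) @ par_cross c y z)
      (shift 2 (par_cross c y z) @ par_cross b x z @ shift 2 (par_cross a x y))"
    by (rule braid_eq_imp_tangle_eq[OF assms[unfolded par_triangle_def]])
      (simp_all add: below par_cross_shift_below del: parallel_crossing.simps)
  then show ?thesis
    using par_cross_shift[of 1]
    by (simp add: parallel_eq_def triangle_def triangle'_def eval_nat_numeral)
qed

text \<open>Whichever strand has the highest level passes over the other two.\<close>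

lemma par_triangle_levels:
  assumes "distinct [l, m, n]" "a = crossing_of_levels l m" "b = crossing_of_levels l n"
    "c = crossing_of_levels m n"
  shows "par_triangle a b c x y z"
proof -
  consider "m < l" "n < l" | "l < m" "n < m" | "l < n" "m < n"
    using assms(1) by (metis distinct_length_2_or_more linorder_neqE_nat order.strict_trans)
  then show ?thesis
    using assms par_triangle_moved[of RisingOver]
    by cases (auto simp: crossing_of_levels_def)
qed

section \<open>Moves at an arbitrary position\<close>

lemma parallel_eq_triangle_shift:
  assumes "\<And>x y z. par_triangle a b c x y z" "layers_top (triangle i a b c) s = Some t"
  shows "parallel_eq f s (triangle i a b c) (triangle' i a b c)"
proof -
  have "parallel_eq f s (shift i (triangle 0 a b c)) (shift i (triangle' 0 a b c))"
  proof (rule parallel_eq_local[where n = 3])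
    show "layers_top (shift i (triangle 0 a b c)) s = Some t"
      using assms(2) by (simp add: shift_patterns)
    show "i + 3 \<le> length s"
      using assms(2) by (auto simp: triangle_def bind_eq_Some_conv split: if_splits)
    show "fits (triangle 0 a b c) 3" by (simp add: triangle_def)
    fix u :: "orientation list" and r
    assume "length u = (3 :: nat)"
    then obtain x y z where "u = [x, y, z]"
      by (auto simp: eval_nat_numeral length_Suc_conv)
    then show "parallel_eq f u (triangle 0 a b c) (triangle' 0 a b c)"
      using parallel_eq_triangle[OF assms(1)] by simp
  qed
  then show ?thesis by (simp add: shift_patterns)
qed

lemma parallel_eq_kink_shift:
  assumes "layers_top m s = Some t" "m = kink_right i d c \<or> m = kink_left i d c"
  shows "parallel_eq f s m []"
proof -
  obtain m0 where m0: "m0 = kink_right 0 d c \<or> m0 = kink_left 0 d c" "m = shift i m0"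
    using assms(2) that[of "kink_right 0 d c"] that[of "kink_left 0 d c"]
    by (auto simp: shift_patterns)
  have "parallel_eq f s (shift i m0) (shift i [])"
  proof (rule parallel_eq_local[where n = 1])
    show "layers_top (shift i m0) s = Some t" using assms(1) m0(2) by simp
    show "i + 1 \<le> length s"
      using assms by (auto simp: kink_right_def kink_left_def bind_eq_Some_conv split: if_splits)
    show "fits m0 1" using m0(1) by (auto simp: kink_right_def kink_left_def)
    fix u :: "orientation list" and r
    assume u: "length u = (1 :: nat)" "layers_top m0 u = Some r"
    then obtain x where x: "u = [x]" by (auto simp: length_Suc_conv)
    from m0(1) show "parallel_eq f u m0 []"
    proof
      assume "m0 = kink_right 0 d c"
      \<comment> \<open>Only this orientation lets the maximum of the kink fit.\<close>
      moreover from this have "x = d"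
        using u(2) x by (cases x; cases d) (auto simp: kink_right_def split: if_splits)
      ultimately show ?thesis using parallel_eq_kink(1) x by simp
    next
      assume "m0 = kink_left 0 d c"
      moreover from this have "x = opp d"
        using u(2) x by (cases x; cases d) (auto simp: kink_left_def split: if_splits)
      ultimately show ?thesis using parallel_eq_kink(2) x by simp
    qed
  qed
  then show ?thesis by (simp add: m0(2))
qed

lemma parallel_eq_bigon_shift:
  assumes "layers_top (bigon i c) s = Some t"
  shows "parallel_eq f s (bigon i c) []"
proof -
  have "parallel_eq f s (shift i (bigon 0 c)) (shift i [])"
  proof (rule parallel_eq_local[where n = 2])
    show "layers_top (shift i (bigon 0 c)) s = Some t" using assms by (simp add: shift_patterns)
    show "i + 2 \<le> length s" using assms by (auto simp: bigon_def split: if_splits)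
    show "fits (bigon 0 c) 2" by (simp add: bigon_def)
    show "parallel_eq f u (bigon 0 c) []" if "length u = 2" for u :: "orientation list"
      using that parallel_eq_bigon by (auto simp: length_eq_2_iff)
  qed
  then show ?thesis by (simp add: shift_patterns)
qed

lemma parallel_eq_isotopy_move:
  assumes "isotopy_move m m'" "layers_top m s = Some t"
  shows "parallel_eq f s m m'"
  using assms
proof (induction rule: isotopy_move.induct)
  case (exchange i p k q)
  then show ?case by (intro parallel_eq_exchange f_opp)
next
  case (straighten_left i d)
  have "parallel_eq f s (shift i [(1, Cup d), (0, Cap)]) (shift i [])"
  proof (rule parallel_eq_local[where n = 1])
    fix u :: "orientation list" and r
    assume u: "length u = (1 :: nat)" "layers_top [(1, Cup d), (0, Cap)] u = Some r"
    then obtain x where x: "u = [x]" by (auto simp: length_Suc_conv)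
    then have "x = opp d" using u(2) by (cases x; cases d) (auto split: if_splits)
    then show "parallel_eq f u [(1, Cup d), (0, Cap)] []" using parallel_eq_straighten(1) x by simp
  qed (use straighten_left in \<open>auto split: if_splits\<close>)
  then show ?case by simp
next
  case (straighten_right i d)
  have "parallel_eq f s (shift i [(0, Cup d), (1, Cap)]) (shift i [])"
  proof (rule parallel_eq_local[where n = 1])
    fix u :: "orientation list" and r
    assume u: "length u = (1 :: nat)" "layers_top [(0, Cup d), (1, Cap)] u = Some r"
    then obtain x where x: "u = [x]" by (auto simp: length_Suc_conv)
    then have "x = d" using u(2) by (cases x; cases d) (auto split: if_splits)
    then show "parallel_eq f u [(0, Cup d), (1, Cap)] []" using parallel_eq_straighten(2) x by simp
  qed (use straighten_right in \<open>auto split: if_splits\<close>)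
  then show ?case by simp
next
  case (cap_through i c)
  have "parallel_eq f s (shift i [(1, Cross c), (0, Cap)]) (shift i [(0, Cross (flip c)), (1, Cap)])"
  proof (rule parallel_eq_local[where n = 3])
    fix u :: "orientation list" and r
    assume u: "length u = (3 :: nat)" "layers_top [(1, Cross c), (0, Cap)] u = Some r"
    then obtain x y z where x: "u = [x, y, z]" by (auto simp: eval_nat_numeral length_Suc_conv)
    then have "z = opp x" using u(2) by (auto split: if_splits)
    then show "parallel_eq f u [(1, Cross c), (0, Cap)] [(0, Cross (flip c)), (1, Cap)]"
      using parallel_eq_cap_through x by simp
  qed (use cap_through in \<open>auto split: if_splits\<close>)
  then show ?case by simp
next
  case (cup_through i d c)
  have "parallel_eq f s (shift i [(0, Cup d), (1, Cross c)]) (shift i [(1, Cup d), (0, Cross (flip c))])"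
  proof (rule parallel_eq_local[where n = 1])
    fix u :: "orientation list"
    assume "length u = (1 :: nat)"
    then obtain x where "u = [x]" by (auto simp: length_Suc_conv)
    then show "parallel_eq f u [(0, Cup d), (1, Cross c)] [(1, Cup d), (0, Cross (flip c))]"
      using parallel_eq_cup_through by simp
  qed (use cup_through in \<open>auto split: if_splits\<close>)
  then show ?case by simp
qed

lemma parallel_eq_local_move:
  assumes "local_move m m'" "layers_top m s = Some t"
  shows "parallel_eq f s m m'"
proof -
  \<comment> \<open>The instance \<open>RisingOver\<close> serves the welded move,
    \<open>Virtual\<close> the triangles of the virtual moves.\<close>
  note moved = par_triangle_moved[of RisingOver, simplified] par_triangle_moved[of Virtual, simplified]
  from assms(1) consider "isotopy_move m m'" | "classical_move m m'" | "virtual_move m m'"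
    | "welded_move m m'"
    unfolding local_move_def by blast
  then show ?thesis
  proof cases
    case 1
    then show ?thesis using parallel_eq_isotopy_move assms(2) by blast
  next
    case 2
    then show ?thesis
    proof cases
      case (R3 x y z a b c i)
      then show ?thesis
        using parallel_eq_triangle_shift[OF par_triangle_levels[OF R3(3-6)]] assms(2) by blast
    qed (use assms(2) in \<open>auto intro!: parallel_eq_kink_shift parallel_eq_bigon_shift\<close>)
  next
    case 3
    then show ?thesis
      using assms(2)
      by cases (auto intro!: parallel_eq_kink_shift parallel_eq_bigon_shift
          parallel_eq_triangle_shift moved)
  next
    case 4
    then show ?thesis
      using assms(2) by cases (auto intro!: parallel_eq_triangle_shift moved)
  qed
qed

section \<open>From local moves to diagrams\<close>

lemma tangle_eq_parallel_layers:
  assumes "diagram_move D D'"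
  shows "tangle_eq [] (parallel_layers f D []) (parallel_layers f D' [])"
proof -
  obtain u m m' v where D: "D = u @ m @ v" "D' = u @ m' @ v" "local_move m m'"
    and "layers_top D [] = Some []"
    using assms by (auto simp: diagram_move_def virtual_link_diagram_def)
  then obtain s t where s: "layers_top u [] = Some s" "layers_top m s = Some t"
    by (auto simp: layers_top_append bind_eq_Some_conv)
  have "parallel_eq f s m m'" using parallel_eq_local_move[OF D(3) s(2)] .
  then have m: "layers_top m' s = Some t"
      "tangle_eq (doubled f s) (parallel_layers f m s) (parallel_layers f m' s)"
    using s(2) by (auto simp: parallel_eq_def)
  have "layers_top (parallel_layers f u []) [] = Some (doubled f s)"
    using parallel_layers_top[where f = f, OF f_opp s(1)] by simp
  then show ?thesis
    using s m by (simp add: D parallel_layers_append tangle_eq.above tangle_eq.below)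
qed

lemma welded_equivalent_parallel_layers:
  assumes "welded_equivalent D D'"
  shows "welded_equivalent (parallel_layers f D []) (parallel_layers f D' [])"
proof (rule tangle_eq_imp_welded_equivalent)
  from assms have "equivclp diagram_move D D'" by (simp add: welded_equivalent_def)
  then show "tangle_eq [] (parallel_layers f D []) (parallel_layers f D' [])"
    by (induction rule: equivclp_induct)
      (blast intro: tangle_eq.refl tangle_eq.sym tangle_eq.trans tangle_eq_parallel_layers)+
  show "virtual_link_diagram (parallel_layers f D [])"
    using assms parallel_layers_top[where f = f, OF f_opp, of D "[]" "[]"]
    by (simp add: welded_equivalent_def virtual_link_diagram_def)
qed

end

theorem theorem2p1:
  fixes D D' :: layers
  assumes "virtual_link_diagram D" and "virtual_link_diagram D'"
    and "welded_equivalent D D'"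
  shows "welded_equivalent (phi_plus D) (phi_plus D')
       \<and> welded_equivalent (phi_minus D) (phi_minus D')"
  unfolding phi_plus_def phi_minus_def
  using assms(3) by (simp add: welded_equivalent_parallel_layers)

end
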